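(* Let $M$ be a space-like surface in the Robertson-Walker space-time $L^4_1(f,c)$, and let $\{e_1,e_2;e_3,e_4\}$ be a (local) orthonormal frame field along $M$, with $e_1,e_2$ tangent and $e_3,e_4$ normal to $M$, and $\theta$ a function, such that $$\left.\frac{\partial}{\partial t}\right|_M=\sinh\theta\, e_1+\cosh\theta\, e_3 .$$ Then $M$ has positive relative nullity if and only if its second fundamental form $h$ satisfies $$h(e_1,e_1)=h(e_1,e_2)=0,\qquad h(e_2,e_2)=\xi$$ for some normal vector field $\xi$.
   Context: For $c\in\{-1,0,1\}$ let $R^3(c)$ be $\mathbb H^3,\mathbb E^3,\mathbb S^3$ respectively (Riemannian space form of constant curvature $c$) with metric $g_c$. Let $I$ be an open interval and $f:I\to\mathbb R$ a smooth nowhere vanishing function. The Robertson-Walker space-time $L^4_1(f,c)$ is $I\times R^3(c)$ with the Lorentzian warped product metric $\langle\cdot,\cdot\rangle=-dt^2+f(t)^2g_c$. A surface $M$ in $L^4_1(f,c)$ is space-like if its induced metric is Riemannian; $h$ is its second fundamental form. Write $\frac{\partial}{\partial t}|_M=T+\eta$ with $T$ tangent and $\eta$ normal to $M$. (For space-like $M$ with $T\neq 0$, $e_1$ is proportional to $T$ and $e_3$ is the time-like unit normal proportional to $\eta$.) The relative null space at $p\in M$ is $\mathcal N_p=\{X\in T_pM: h_p(X,Y)=0\ \text{for all } Y\in T_pM\}$; $M$ has positive relative nullity if $\dim\mathcal N_p>0$ for all $p\in M$. Standing assumptions: (i) $\frac{f''(t)}{f(t)}-\frac{f'(t)^2+c}{f(t)^2}\neq0$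 for all $t\in I$; (ii) $T$ does not vanish on $M$; (iii) when $M$ has positive relative nullity, the spaces $\mathcal N_p$ form a smooth 1-dimensional distribution; (iv) $M$ is connected and no open part of $M$ lies in a 3-dimensional totally geodesic hypersurface of $L^4_1(f,c)$. *)

theory Defs
  imports "HOL-Analysis.Analysis"
begin

section \<open>Smooth maps\<close>

text \<open>Only used for open domains.\<close>

primrec Ck_on :: "nat \<Rightarrow> 'a::real_normed_vector set \<Rightarrow> ('a \<Rightarrow> 'b::real_normed_vector) \<Rightarrow> bool" where
  "Ck_on 0 S F \<longleftrightarrow> continuous_on S F"
| "Ck_on (Suc k) S F \<longleftrightarrow>
     (\<forall>p\<in>S. F differentiable (at p)) \<and> (\<forall>v. Ck_on k S (\<lambda>p. frechet_derivative F (at p) v))"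

definition smooth_on :: "'a::real_normed_vector set \<Rightarrow> ('a \<Rightarrow> 'b::real_normed_vector) \<Rightarrow> bool" where
  "smooth_on S F \<longleftrightarrow> (\<forall>k. Ck_on k S F)"

section \<open>Robertson-Walker space-times\<close>

text \<open>
  The three space forms are treated uniformly as the hypersurfaces
  \<open>s\<^sup>2 + c \<bar>y\<bar>\<^sup>2 = 1\<close> (with \<open>s > 0\<close> if \<open>c \<le> 0\<close>) of the space of pairs \<open>(s, y)\<close>, \<open>y\<close> in Euclidean
  3-space, with the metric induced by \<open>c ds\<^sup>2 + \<bar>dy\<bar>\<^sup>2\<close>:
  for \<open>c = 1\<close> the unit sphere, for \<open>c = -1\<close> the hyperboloid model in Minkowski space, and for
  \<open>c = 0\<close> the affine hyperplane \<open>s = 1\<close>, that is, a copy of Euclidean 3-space.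
  Points and tangent vectors of the space-time are triples \<open>(t, s, y)\<close>.
\<close>

type_synonym amb = "real \<times> real \<times> (real^3)"

definition space_form :: "real \<Rightarrow> (real \<times> (real^3)) set" where
  "space_form c = {(s, y). s\<^sup>2 + c * (y \<bullet> y) = 1 \<and> (c \<le> 0 \<longrightarrow> s > 0)}"

definition space_form_metric :: "real \<Rightarrow> real \<times> (real^3) \<Rightarrow> real \<times> (real^3) \<Rightarrow> real" where
  "space_form_metric c v w = c * fst v * fst w + snd v \<bullet> snd w"

definition rw_space :: "real set \<Rightarrow> real \<Rightarrow> amb set" where
  "rw_space I c = I \<times> space_form c"

text \<open>The tangent space at \<open>p\<close>: the kernel of the differential of \<open>s\<^sup>2 + c \<bar>y\<bar>\<^sup>2\<close>.\<close>

definition rw_tangent :: "real \<Rightarrow> amb \<Rightarrow> amb set" where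
  "rw_tangent c p = {v. fst (snd p) * fst (snd v) + c * (snd (snd p) \<bullet> snd (snd v)) = 0}"

definition rw_metric :: "(real \<Rightarrow> real) \<Rightarrow> real \<Rightarrow> amb \<Rightarrow> amb \<Rightarrow> amb \<Rightarrow> real" where
  "rw_metric f c p v w =
     - (fst v * fst w) + (f (fst p))\<^sup>2 * space_form_metric c (snd v) (snd w)"

definition partial_t :: amb where
  "partial_t = (1, 0, 0)"

text \<open>
  The Levi-Civita connection, given by the Koszul formula. For vector fields \<open>U, V, W\<close> tangent to
  the space-time, \<open>\<nabla>\<^sub>U V\<close> is the tangent vector with
  \<open>\<langle>\<nabla>\<^sub>U V, W\<rangle> = \<langle>dV(U), W\<rangle> + K(U, V, W)\<close>, where \<open>dV\<close> is the ordinary derivative in the ambient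
  vector space and \<open>K\<close> collects the derivatives of the metric coefficients (for \<open>U, V, W\<close> constant,
  \<open>K\<close> is the Christoffel symbol of the first kind). Since only
  the point \<open>p\<close>, \<open>u = U(p)\<close>, \<open>v = V(p)\<close> and \<open>v' = dV(u)\<close> enter, the formula also applies to vector
  fields along maps into the space-time.
\<close>

definition koszul_term :: "(real \<Rightarrow> real) \<Rightarrow> real \<Rightarrow> amb \<Rightarrow> amb \<Rightarrow> amb \<Rightarrow> amb \<Rightarrow> real" where
  "koszul_term f c p u v w =
     (frechet_derivative (\<lambda>q. rw_metric f c q v w) (at p) u
      + frechet_derivative (\<lambda>q. rw_metric f c q u w) (at p) v
      - frechet_derivative (\<lambda>q. rw_metric f c q u v) (at p) w) / 2"

definition rw_cov :: "(real \<Rightarrow> real) \<Rightarrow> real \<Rightarrow> amb \<Rightarrow> amb \<Rightarrow> amb \<Rightarrow> amb \<Rightarrow> amb" where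
  "rw_cov f c p u v v' =
     (THE z. z \<in> rw_tangent c p \<and>
        (\<forall>w\<in>rw_tangent c p. rw_metric f c p z w = rw_metric f c p v' w + koszul_term f c p u v w))"

text \<open>
  An (embedded) hypersurface \<open>S\<close> is locally the zero set of a function \<open>F\<close> whose differential does not
  vanish on the tangent space of the space-time. It is totally geodesic if the covariant
  derivative in the space-time of a tangent field of \<open>S\<close>, along any curve in \<open>S\<close>, is tangent
  to \<open>S\<close> (vanishing second fundamental form). Tangent vectors of \<open>S\<close> are the tangent vectors of the
  space-time annihilated by \<open>dF\<close>; no non-degeneracy of the induced metric is required.
\<close>

definition totally_geodesic_hypersurface ::
    "(real \<Rightarrow> real) \<Rightarrow> real set \<Rightarrow> real \<Rightarrow> amb set \<Rightarrow> bool" where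
  "totally_geodesic_hypersurface f I c S \<longleftrightarrow>
     S \<subseteq> rw_space I c \<and>
     (\<forall>p\<in>S. \<exists>W (F :: amb \<Rightarrow> real).
        open W \<and> p \<in> W \<and> smooth_on W F \<and>
        S \<inter> W = {q \<in> rw_space I c \<inter> W. F q = 0} \<and>
        (\<forall>q\<in>S \<inter> W. \<exists>w\<in>rw_tangent c q. frechet_derivative F (at q) w \<noteq> 0) \<and>
        (\<forall>J (\<gamma> :: real \<Rightarrow> amb) (V :: real \<Rightarrow> amb).
           open J \<and> is_interval J \<and> smooth_on J \<gamma> \<and> smooth_on J V \<and> \<gamma> ` J \<subseteq> S \<inter> W \<and>
           (\<forall>\<tau>\<in>J. V \<tau> \<in> rw_tangent c (\<gamma> \<tau>) \<and> frechet_derivative F (at (\<gamma> \<tau>)) (V \<tau>) = 0)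
           \<longrightarrow> (\<forall>\<tau>\<in>J. frechet_derivative F (at (\<gamma> \<tau>))
                  (rw_cov f c (\<gamma> \<tau>) (vector_derivative \<gamma> (at \<tau>)) (V \<tau>)
                     (vector_derivative V (at \<tau>))) = 0)))"

section \<open>Immersed surfaces\<close>

text \<open>
  The surface \<open>M\<close> is a Hausdorff, second countable space (the whole type \<open>'m\<close>) with a smooth atlas of
  charts \<open>(U, \<psi>)\<close>, together with an immersion \<open>x\<close> into the space-time. Tangent vectors of \<open>M\<close> are
  identified with their images under \<open>dx\<close>, and vector fields along \<open>M\<close> are maps from \<open>'m\<close> to the
  ambient vector space.
\<close>

type_synonym 'm chart = "'m set \<times> ('m \<Rightarrow> real^2)"

definition in_chart :: "'m chart \<Rightarrow> ('m \<Rightarrow> 'b) \<Rightarrow> real^2 \<Rightarrow> 'b" where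
  "in_chart \<kappa> F = F \<circ> inv_into (fst \<kappa>) (snd \<kappa>)"

definition smooth_surface_atlas ::
    "'m::{t2_space, second_countable_topology} chart set \<Rightarrow> bool" where
  "smooth_surface_atlas A \<longleftrightarrow>
     (\<Union>\<kappa>\<in>A. fst \<kappa>) = UNIV \<and>
     (\<forall>(U, \<psi>)\<in>A. open U \<and> open (\<psi> ` U) \<and> homeomorphism U (\<psi> ` U) \<psi> (inv_into U \<psi>)) \<and>
     (\<forall>(U, \<psi>)\<in>A. \<forall>(U', \<psi>')\<in>A. smooth_on (\<psi> ` (U \<inter> U')) (in_chart (U, \<psi>) \<psi>'))"

definition smooth_map :: "'m chart set \<Rightarrow> 'm set \<Rightarrow> ('m \<Rightarrow> 'b::real_normed_vector) \<Rightarrow> bool" where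
  "smooth_map A W F \<longleftrightarrow> (\<forall>(U, \<psi>)\<in>A. smooth_on (\<psi> ` (U \<inter> W)) (in_chart (U, \<psi>) F))"

definition immersed_surface ::
    "real set \<Rightarrow> real \<Rightarrow> 'm::{t2_space, second_countable_topology} chart set \<Rightarrow> ('m \<Rightarrow> amb) \<Rightarrow> bool" where
  "immersed_surface I c A x \<longleftrightarrow>
     smooth_surface_atlas A \<and> range x \<subseteq> rw_space I c \<and> smooth_map A UNIV x \<and>
     (\<forall>(U, \<psi>)\<in>A. \<forall>m\<in>U. inj (frechet_derivative (in_chart (U, \<psi>) x) (at (\<psi> m))))"

definition tangent_plane :: "'m chart set \<Rightarrow> ('m \<Rightarrow> amb) \<Rightarrow> 'm \<Rightarrow> amb set" where
  "tangent_plane A x m =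
     {X. \<exists>(U, \<psi>)\<in>A. m \<in> U \<and> (\<exists>a. X = frechet_derivative (in_chart (U, \<psi>) x) (at (\<psi> m)) a)}"

text \<open>Derivative of \<open>F\<close> at \<open>m\<close> in the direction of the tangent vector represented by \<open>X\<close>.\<close>

definition dir_deriv ::
    "'m chart set \<Rightarrow> ('m \<Rightarrow> amb) \<Rightarrow> ('m \<Rightarrow> 'b::real_normed_vector) \<Rightarrow> 'm \<Rightarrow> amb \<Rightarrow> 'b" where
  "dir_deriv A x F m X =
     (THE d. \<exists>(U, \<psi>)\<in>A. m \<in> U \<and>
        (\<exists>a. X = frechet_derivative (in_chart (U, \<psi>) x) (at (\<psi> m)) a \<and>
             d = frechet_derivative (in_chart (U, \<psi>) F) (at (\<psi> m)) a))"

definition spacelike :: "(real \<Rightarrow> real) \<Rightarrow> real \<Rightarrow> 'm chart set \<Rightarrow> ('m \<Rightarrow> amb) \<Rightarrow> bool" where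
  "spacelike f c A x \<longleftrightarrow>
     (\<forall>m. \<forall>X\<in>tangent_plane A x m. X \<noteq> 0 \<longrightarrow> rw_metric f c (x m) X X > 0)"

definition normal_plane ::
    "(real \<Rightarrow> real) \<Rightarrow> real \<Rightarrow> 'm chart set \<Rightarrow> ('m \<Rightarrow> amb) \<Rightarrow> 'm \<Rightarrow> amb set" where
  "normal_plane f c A x m =
     {n \<in> rw_tangent c (x m). \<forall>X\<in>tangent_plane A x m. rw_metric f c (x m) n X = 0}"

definition normal_part ::
    "(real \<Rightarrow> real) \<Rightarrow> real \<Rightarrow> 'm chart set \<Rightarrow> ('m \<Rightarrow> amb) \<Rightarrow> 'm \<Rightarrow> amb \<Rightarrow> amb" where
  "normal_part f c A x m v =
     (THE n. n \<in> normal_plane f c A x m \<and> v - n \<in> tangent_plane A x m)"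

definition tangential_part ::
    "(real \<Rightarrow> real) \<Rightarrow> real \<Rightarrow> 'm chart set \<Rightarrow> ('m \<Rightarrow> amb) \<Rightarrow> 'm \<Rightarrow> amb \<Rightarrow> amb" where
  "tangential_part f c A x m v = v - normal_part f c A x m v"

definition tangent_field ::
    "'m chart set \<Rightarrow> ('m \<Rightarrow> amb) \<Rightarrow> 'm set \<Rightarrow> ('m \<Rightarrow> amb) \<Rightarrow> bool" where
  "tangent_field A x W V \<longleftrightarrow> smooth_map A W V \<and> (\<forall>q\<in>W. V q \<in> tangent_plane A x q)"

definition normal_field ::
    "(real \<Rightarrow> real) \<Rightarrow> real \<Rightarrow> 'm chart set \<Rightarrow> ('m \<Rightarrow> amb) \<Rightarrow> 'm set \<Rightarrow> ('m \<Rightarrow> amb) \<Rightarrow> bool" where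
  "normal_field f c A x W V \<longleftrightarrow> smooth_map A W V \<and> (\<forall>q\<in>W. V q \<in> normal_plane f c A x q)"

text \<open>
  \<open>h(X, Y)\<close> is the normal part of \<open>\<nabla>\<^sub>X V\<close>, where \<open>V\<close> is any tangent field near \<open>m\<close> extending \<open>Y\<close>.
\<close>

definition second_ff ::
    "(real \<Rightarrow> real) \<Rightarrow> real \<Rightarrow> 'm::topological_space chart set \<Rightarrow> ('m \<Rightarrow> amb) \<Rightarrow> 'm \<Rightarrow> amb \<Rightarrow> amb \<Rightarrow> amb" where
  "second_ff f c A x m X Y =
     (THE z. \<exists>W V. open W \<and> m \<in> W \<and> tangent_field A x W V \<and> V m = Y \<and>
        z = normal_part f c A x m (rw_cov f c (x m) X Y (dir_deriv A x V m X)))"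

definition relative_null_space ::
    "(real \<Rightarrow> real) \<Rightarrow> real \<Rightarrow> 'm::topological_space chart set \<Rightarrow> ('m \<Rightarrow> amb) \<Rightarrow> 'm \<Rightarrow> amb set" where
  "relative_null_space f c A x m =
     {X \<in> tangent_plane A x m. \<forall>Y\<in>tangent_plane A x m. second_ff f c A x m X Y = 0}"

definition positive_relative_nullity ::
    "(real \<Rightarrow> real) \<Rightarrow> real \<Rightarrow> 'm::topological_space chart set \<Rightarrow> ('m \<Rightarrow> amb) \<Rightarrow> bool" where
  "positive_relative_nullity f c A x \<longleftrightarrow> (\<forall>m. dim (relative_null_space f c A x m) > 0)"

definition smooth_line_distribution ::
    "'m::topological_space chart set \<Rightarrow> ('m \<Rightarrow> amb) \<Rightarrow> ('m \<Rightarrow> amb set) \<Rightarrow> bool" where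
  "smooth_line_distribution A x D \<longleftrightarrow>
     (\<forall>m. \<exists>W V. open W \<and> m \<in> W \<and> tangent_field A x W V \<and>
        (\<forall>q\<in>W. V q \<noteq> 0 \<and> D q = span {V q}))"

text \<open>Orthonormality is with respect to the Lorentzian metric; \<open>e3\<close> is the time-like vector.\<close>

definition adapted_frame ::
    "(real \<Rightarrow> real) \<Rightarrow> real \<Rightarrow> 'm::topological_space chart set \<Rightarrow> ('m \<Rightarrow> amb) \<Rightarrow> 'm set \<Rightarrow>
     ('m \<Rightarrow> amb) \<Rightarrow> ('m \<Rightarrow> amb) \<Rightarrow> ('m \<Rightarrow> amb) \<Rightarrow> ('m \<Rightarrow> amb) \<Rightarrow> ('m \<Rightarrow> real) \<Rightarrow> bool" where
  "adapted_frame f c A x U e1 e2 e3 e4 \<theta> \<longleftrightarrow>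
     open U \<and>
     tangent_field A x U e1 \<and> tangent_field A x U e2 \<and>
     normal_field f c A x U e3 \<and> normal_field f c A x U e4 \<and>
     (\<forall>q\<in>U. let g = rw_metric f c (x q) in
        g (e1 q) (e1 q) = 1 \<and> g (e2 q) (e2 q) = 1 \<and> g (e3 q) (e3 q) = -1 \<and> g (e4 q) (e4 q) = 1 \<and>
        g (e1 q) (e2 q) = 0 \<and> g (e1 q) (e3 q) = 0 \<and> g (e1 q) (e4 q) = 0 \<and>
        g (e2 q) (e3 q) = 0 \<and> g (e2 q) (e4 q) = 0 \<and> g (e3 q) (e4 q) = 0 \<and>
        partial_t = sinh (\<theta> q) *\<^sub>R e1 q + cosh (\<theta> q) *\<^sub>R e3 q)"

end

(*
  A null direction X (h(X, .) = 0) makes covariant derivatives in the direction X preserve tangency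
  to M, so the normal part of the curvature R(X, Y)X reduces to h(Y, D_X X). Its e4-component is zero
  because e4 is orthogonal to d/dt; hence, where the e4-component h4 of h is nonzero, D_X X is
  proportional to X and the e3-component vanishes as well. Up to a nonzero factor containing
  f''/f - (f'^2 + c)/f^2, this e3-component at Y = e2 is <X, d/dt><X, e2>, and at Y = e1 it
  excludes <X, d/dt> = 0, whence X is proportional to e1. If instead h4 vanished on an open set,
  then e4 would be parallel there, the component of f e4 along the space form would be a constant
  vector, and an open part of M would lie in the totally geodesic hypersurface orthogonal to it.
  So X is proportional to e1 on a dense set, hence everywhere.
*)
theory Submission
  imports Defs
begin

section \<open>Calculus of smooth maps\<close>

text \<open>Covariant derivatives are taken along constant directions of a chart. Coordinate fields
  commute, so no bracket terms arise; the null field is frozen into such a direction at the point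
  considered. The form h enters through derivatives of the normal fields, as the numbers <h(dr a,
  Y), n> up to sign. These are visibly linear in Y and need no extension of Y to a field, whereas
  \<open>second_ff\<close> is a definite description over all extensions. The hypothesis that T does
  not vanish enters as sinh \<theta> \<noteq> 0: then e1 has a nonzero time component, and a null
  vector X orthogonal to d/dt would satisfy <X, X> = 0. The obstacle is the set where h4 vanishes:
  there D_X X cannot be compared with X by linear algebra, and the curvature identity alone does not
  decide. Only the global hypothesis on totally geodesic hypersurfaces excludes an open set of this
  kind. The converse is linear algebra at a point: e1 is itself a null vector. What remains for the
  forward direction is the smoothness of \<xi>, which needs its own argument since the coordinate
  vector representing e2 is only chosen pointwise.\<close>

lemma Ck_on_subset: "Ck_on k S F \<Longrightarrow> T \<subseteq> S \<Longrightarrow> Ck_on k T F"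
  by (induction k arbitrary: F) (auto intro: continuous_on_subset)

lemma frechet_derivative_cong_open:
  assumes "open S" "p \<in> S" "\<And>q. q \<in> S \<Longrightarrow> F q = G q"
  shows "frechet_derivative F (at p) = frechet_derivative G (at p)"
proof -
  have "(F has_derivative D) (at p) \<longleftrightarrow> (G has_derivative D) (at p)" for D
    using assms by (auto elim!: has_derivative_transform_within_open)
  then show ?thesis
    unfolding frechet_derivative_def by simp
qed

lemma differentiable_cong_open:
  assumes "open S" "p \<in> S" "\<And>q. q \<in> S \<Longrightarrow> F q = G q" "F differentiable (at p)"
  shows "G differentiable (at p)"
  using assms unfolding differentiable_def by (metis has_derivative_transform_within_open)

text \<open>Openness lets equality on \<open>S\<close> pass to the derivatives at points of
  \<open>S\<close>. The inductions for composite maps use this to replace a derivative by its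
  explicit formula.\<close>

lemma Ck_on_cong:
  assumes "open S" "\<And>q. q \<in> S \<Longrightarrow> F q = G q" "Ck_on k S F"
  shows "Ck_on k S G"
  using assms(2,3)
proof (induction k arbitrary: F G)
  case 0
  then show ?case by (simp cong: continuous_on_cong)
next
  case (Suc k)
  have "Ck_on k S (\<lambda>p. frechet_derivative G (at p) v)" for v
    by (rule Suc.IH[of "\<lambda>p. frechet_derivative F (at p) v"])
      (use Suc.prems frechet_derivative_cong_open[OF assms(1), of _ F G] in auto)
  then show ?case
    using Suc.prems differentiable_cong_open[OF assms(1), of _ F G] by auto
qed

lemma Ck_on_Suc_imp: "Ck_on (Suc k) S F \<Longrightarrow> Ck_on k S F"
proof (induction k arbitrary: F)
  case 0
  then show ?case
    by (auto intro!: continuous_at_imp_continuous_on differentiable_imp_continuous_within)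
next
  case (Suc k)
  then show ?case by (metis Ck_on.simps(2))
qed

lemma Ck_on_const: "Ck_on k S (\<lambda>_. b)"
  by (induction k arbitrary: b) auto

lemma Ck_on_bounded_linear:
  assumes "open S" "bounded_linear L" "Ck_on k S F"
  shows "Ck_on k S (\<lambda>q. L (F q))"
  using assms(3)
proof (induction k arbitrary: F)
  case 0
  then show ?case
    using bounded_linear.continuous_on[OF assms(2)] by simp
next
  case (Suc k)
  have D: "((\<lambda>q. L (F q)) has_derivative (\<lambda>v. L (frechet_derivative F (at p) v))) (at p)"
    if "p \<in> S" for p
    using Suc.prems that frechet_derivative_works
    by (intro bounded_linear.has_derivative[OF assms(2)]) auto
  have "Ck_on k S (\<lambda>p. frechet_derivative (\<lambda>q. L (F q)) (at p) v)" for v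
    by (rule Ck_on_cong[OF assms(1) _ Suc.IH[of "\<lambda>p. frechet_derivative F (at p) v"]])
      (use Suc.prems frechet_derivative_at[OF D] in \<open>auto simp: fun_eq_iff\<close>)
  then show ?case
    using D by (auto simp: differentiable_def)
qed

lemma Ck_on_add:
  assumes "open S" "Ck_on k S F" "Ck_on k S G"
  shows "Ck_on k S (\<lambda>q. F q + G q)"
  using assms(2,3)
proof (induction k arbitrary: F G)
  case 0
  then show ?case by (simp add: continuous_on_add)
next
  case (Suc k)
  have D: "((\<lambda>q. F q + G q) has_derivative
      (\<lambda>v. frechet_derivative F (at p) v + frechet_derivative G (at p) v)) (at p)"
    if "p \<in> S" for p
    using Suc.prems that by (intro has_derivative_add) (auto simp flip: frechet_derivative_works)
  have "Ck_on k S (\<lambda>p. frechet_derivative (\<lambda>q. F q + G q) (at p) v)" for v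
    by (rule Ck_on_cong[OF assms(1) _ Suc.IH[of "\<lambda>p. frechet_derivative F (at p) v"
            "\<lambda>p. frechet_derivative G (at p) v"]])
      (use Suc.prems frechet_derivative_at[OF D] in \<open>auto simp: fun_eq_iff\<close>)
  then show ?case
    using D by (auto simp: differentiable_def)
qed

text \<open>The product rule pairs each factor with the derivative of the other, so the induction
  runs over both factors at once and also needs the undifferentiated factors one order
  lower.\<close>

lemma Ck_on_bilinear:
  assumes "open S" "bounded_bilinear B" "Ck_on k S F" "Ck_on k S G"
  shows "Ck_on k S (\<lambda>q. B (F q) (G q))"
  using assms(3,4)
proof (induction k arbitrary: F G)
  case 0
  then show ?case
    using bounded_bilinear.continuous_on[OF assms(2)] by auto
next
  case (Suc k)
  have D: "((\<lambda>q. B (F q) (G q)) has_derivative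
      (\<lambda>v. B (F p) (frechet_derivative G (at p) v) + B (frechet_derivative F (at p) v) (G p))) (at p)"
    if "p \<in> S" for p
    using Suc.prems that
    by (intro bounded_bilinear.FDERIV[OF assms(2)]) (auto simp flip: frechet_derivative_works)
  have F: "Ck_on k S F" "Ck_on k S G"
    using Suc.prems Ck_on_Suc_imp by blast+
  have "Ck_on k S (\<lambda>p. frechet_derivative (\<lambda>q. B (F q) (G q)) (at p) v)" for v
    by (rule Ck_on_cong[OF assms(1) _ Ck_on_add[OF assms(1)
            Suc.IH[of F "\<lambda>p. frechet_derivative G (at p) v"]
            Suc.IH[of "\<lambda>p. frechet_derivative F (at p) v" G]]])
      (use Suc.prems F frechet_derivative_at[OF D] in \<open>auto simp: fun_eq_iff\<close>)
  then show ?case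
    using D by (auto simp: differentiable_def)
qed

text \<open>The chain rule in the only form required, with an outer function of one real variable:
  the derivative is a product of dg and h' composed with g, which returns the problem to
  \<open>Ck_on_bilinear\<close> and to h'. It serves for f(t), f'(t) and quotients.\<close>

lemma Ck_on_compose_real:
  fixes g :: "'a::real_normed_vector \<Rightarrow> real" and h :: "real \<Rightarrow> 'b::real_normed_vector"
  assumes "open S" "Ck_on k J h" "Ck_on k S g" "g ` S \<subseteq> J"
  shows "Ck_on k S (\<lambda>q. h (g q))"
  using assms(2,3)
proof (induction k arbitrary: h)
  case 0
  then show ?case
    using assms(4) by (auto intro: continuous_on_compose2)
next
  case (Suc k)
  have D: "((\<lambda>q. h (g q)) has_derivative
      (\<lambda>v. frechet_derivative g (at p) v *\<^sub>R frechet_derivative h (at (g p)) 1)) (at p)"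
    if "p \<in> S" for p
  proof -
    have h: "(h has_derivative frechet_derivative h (at (g p))) (at (g p))"
      using Suc.prems(1) assms(4) that frechet_derivative_works by fastforce
    have lin: "linear (frechet_derivative h (at (g p)))"
      using h has_derivative_linear by blast
    have eq: "frechet_derivative h (at (g p)) s = s *\<^sub>R frechet_derivative h (at (g p)) 1" for s
      using linear_cmul[OF lin, of s 1] by simp
    have "((\<lambda>q. h (g q)) has_derivative
        (\<lambda>v. frechet_derivative h (at (g p)) (frechet_derivative g (at p) v))) (at p)"
      using Suc.prems(2) that
      by (intro has_derivative_compose[where f = g and g = h, OF _ h])
        (auto simp flip: frechet_derivative_works)
    then show ?thesis
      by (subst (asm) eq)
  qed
  have g: "Ck_on k S g"
    using Suc.prems Ck_on_Suc_imp by blast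
  have "Ck_on k S (\<lambda>p. frechet_derivative (\<lambda>q. h (g q)) (at p) v)" for v
    by (rule Ck_on_cong[OF assms(1) _ Ck_on_bilinear[OF assms(1) bounded_bilinear_scaleR
            _ Suc.IH[of "\<lambda>t. frechet_derivative h (at t) 1"],
            of "\<lambda>p. frechet_derivative g (at p) v"]])
      (use Suc.prems g frechet_derivative_at[OF D] in \<open>auto simp: fun_eq_iff\<close>)
  then show ?case
    using D by (auto simp: differentiable_def)
qed

text \<open>The derivative is minus the square of the function itself, so the induction hypothesis
  is applied to both factors of that square.\<close>

lemma Ck_on_inverse: "Ck_on k (-{0}) (inverse :: real \<Rightarrow> real)"
proof (induction k)
  case 0
  then show ?case by (auto intro!: continuous_intros)
next
  case (Suc k)
  have D: "((inverse :: real \<Rightarrow> real) has_derivative (\<lambda>v. - (inverse p * v * inverse p))) (at p)"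
    if "p \<in> -{0}" for p
    using has_derivative_inverse'[of p UNIV] that by auto
  have "Ck_on k (-{0}) (\<lambda>p. frechet_derivative (inverse :: real \<Rightarrow> real) (at p) v)" for v
    by (rule Ck_on_cong[OF _ _ Ck_on_bounded_linear[OF _ bounded_linear_mult_right[of "-v"]
            Ck_on_bilinear[OF _ bounded_bilinear_mult Suc Suc]]])
      (use frechet_derivative_at[OF D] in \<open>auto simp: fun_eq_iff algebra_simps open_Compl\<close>)
  then show ?case
    using D by (auto simp: differentiable_def)
qed

section \<open>Closure properties of smooth maps\<close>

lemma smooth_on_subset: "smooth_on S F \<Longrightarrow> T \<subseteq> S \<Longrightarrow> smooth_on T F"
  unfolding smooth_on_def using Ck_on_subset by blast

lemma smooth_on_cong:
  "open S \<Longrightarrow> (\<And>q. q \<in> S \<Longrightarrow> F q = G q) \<Longrightarrow> smooth_on S F \<Longrightarrow> smooth_on S G"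
  unfolding smooth_on_def using Ck_on_cong by blast

lemma smooth_on_const: "smooth_on S (\<lambda>_. b)"
  unfolding smooth_on_def using Ck_on_const by blast

lemma smooth_on_ident: "smooth_on S (\<lambda>q. q)"
proof -
  have "Ck_on k S (\<lambda>q. q)" for k
    by (cases k) (auto simp: Ck_on_const)
  then show ?thesis
    by (simp add: smooth_on_def)
qed

lemma smooth_on_bounded_linear:
  "open S \<Longrightarrow> bounded_linear L \<Longrightarrow> smooth_on S F \<Longrightarrow> smooth_on S (\<lambda>q. L (F q))"
  unfolding smooth_on_def using Ck_on_bounded_linear by blast

lemma smooth_on_add:
  "open S \<Longrightarrow> smooth_on S F \<Longrightarrow> smooth_on S G \<Longrightarrow> smooth_on S (\<lambda>q. F q + G q)"
  unfolding smooth_on_def using Ck_on_add by blast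

lemma smooth_on_bilinear:
  "open S \<Longrightarrow> bounded_bilinear B \<Longrightarrow> smooth_on S F \<Longrightarrow> smooth_on S G \<Longrightarrow>
    smooth_on S (\<lambda>q. B (F q) (G q))"
  unfolding smooth_on_def using Ck_on_bilinear by blast

lemma smooth_on_compose_real:
  fixes g :: "'a::real_normed_vector \<Rightarrow> real"
  shows "open S \<Longrightarrow> smooth_on J h \<Longrightarrow> smooth_on S g \<Longrightarrow> g ` S \<subseteq> J \<Longrightarrow> smooth_on S (\<lambda>q. h (g q))"
  unfolding smooth_on_def using Ck_on_compose_real by blast

lemma smooth_on_uminus: "open S \<Longrightarrow> smooth_on S F \<Longrightarrow> smooth_on S (\<lambda>q. - F q)"
  by (rule smooth_on_bounded_linear[OF _ bounded_linear_minus[OF bounded_linear_ident]])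

lemma smooth_on_diff:
  "open S \<Longrightarrow> smooth_on S F \<Longrightarrow> smooth_on S G \<Longrightarrow> smooth_on S (\<lambda>q. F q - G q)"
  using smooth_on_add[of S F "\<lambda>q. - G q"] smooth_on_uminus[of S G] by simp

lemma smooth_on_mult:
  fixes F G :: "'a::real_normed_vector \<Rightarrow> real"
  shows "open S \<Longrightarrow> smooth_on S F \<Longrightarrow> smooth_on S G \<Longrightarrow> smooth_on S (\<lambda>q. F q * G q)"
  by (rule smooth_on_bilinear[OF _ bounded_bilinear_mult])

lemma smooth_on_scaleR:
  "open S \<Longrightarrow> smooth_on S F \<Longrightarrow> smooth_on S G \<Longrightarrow> smooth_on S (\<lambda>q. F q *\<^sub>R G q)"
  by (rule smooth_on_bilinear[OF _ bounded_bilinear_scaleR])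

lemma smooth_on_divide:
  fixes F G :: "'a::real_normed_vector \<Rightarrow> real"
  assumes "open S" "smooth_on S F" "smooth_on S G" "\<And>q. q \<in> S \<Longrightarrow> G q \<noteq> 0"
  shows "smooth_on S (\<lambda>q. F q / G q)"
proof -
  have "smooth_on (-{0}) (inverse :: real \<Rightarrow> real)"
    unfolding smooth_on_def using Ck_on_inverse by blast
  then have "smooth_on S (\<lambda>q. inverse (G q))"
    using assms by (intro smooth_on_compose_real[of S "-{0}" inverse G]) auto
  then show ?thesis
    unfolding divide_inverse using assms by (intro smooth_on_mult)
qed

lemma smooth_on_Pair:
  assumes "open S" "smooth_on S F" "smooth_on S G"
  shows "smooth_on S (\<lambda>q. (F q, G q))"
proof -
  have "smooth_on S (\<lambda>q. (F q, 0) + (0, G q))"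
    by (intro smooth_on_add smooth_on_bounded_linear[of S "\<lambda>u. (u, 0)" F]
        smooth_on_bounded_linear[of S "\<lambda>u. (0, u)" G] bounded_linear_Pair bounded_linear_ident
        bounded_linear_zero assms)
  then show ?thesis by simp
qed

lemma smooth_on_sum:
  assumes "open S" "\<And>i. i \<in> J \<Longrightarrow> smooth_on S (F i)"
  shows "smooth_on S (\<lambda>q. \<Sum>i\<in>J. F i q)"
  using assms(2)
  by (induction J rule: infinite_finite_induct) (auto intro: smooth_on_const smooth_on_add assms(1))

lemma smooth_on_fst: "open S \<Longrightarrow> smooth_on S F \<Longrightarrow> smooth_on S (\<lambda>q. fst (F q))"
  by (rule smooth_on_bounded_linear[OF _ bounded_linear_fst])

lemma smooth_on_snd: "open S \<Longrightarrow> smooth_on S F \<Longrightarrow> smooth_on S (\<lambda>q. snd (F q))"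
  by (rule smooth_on_bounded_linear[OF _ bounded_linear_snd])

lemma smooth_on_frechet_derivative:
  "smooth_on S F \<Longrightarrow> smooth_on S (\<lambda>p. frechet_derivative F (at p) v)"
  unfolding smooth_on_def by (metis Ck_on.simps(2))

lemma smooth_on_imp_differentiable:
  "smooth_on S F \<Longrightarrow> p \<in> S \<Longrightarrow> F differentiable (at p)"
  unfolding smooth_on_def by (metis Ck_on.simps(2))

lemma smooth_on_imp_has_derivative:
  "smooth_on S F \<Longrightarrow> p \<in> S \<Longrightarrow> (F has_derivative frechet_derivative F (at p)) (at p)"
  using smooth_on_imp_differentiable frechet_derivative_works by blast

lemma smooth_on_imp_continuous_on: "smooth_on S F \<Longrightarrow> continuous_on S F"
  unfolding smooth_on_def by (metis Ck_on.simps(1))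

lemma smooth_on_deriv:
  fixes f :: "real \<Rightarrow> real"
  assumes "open S" "smooth_on S f"
  shows "smooth_on S (deriv f)"
proof (rule smooth_on_cong[OF assms(1)])
  show "smooth_on S (\<lambda>p. frechet_derivative f (at p) 1)"
    using assms(2) by (rule smooth_on_frechet_derivative)
  show "frechet_derivative f (at q) 1 = deriv f q" if "q \<in> S" for q
  proof -
    have "(f has_derivative frechet_derivative f (at q)) (at q)"
      using assms(2) that by (rule smooth_on_imp_has_derivative)
    moreover have "frechet_derivative f (at q) = (\<lambda>x. frechet_derivative f (at q) 1 * x)"
    proof
      show "frechet_derivative f (at q) x = frechet_derivative f (at q) 1 * x" for x
        using linear_cmul[OF has_derivative_linear[OF calculation], of x 1] by (simp add: mult.commute)
    qed
    ultimately have "(f has_real_derivative frechet_derivative f (at q) 1) (at q)"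
      unfolding has_field_derivative_def by metis
    then show ?thesis by (rule DERIV_imp_deriv[symmetric])
  qed
qed

lemma smooth_on_imp_DERIV:
  fixes f :: "real \<Rightarrow> real"
  assumes "smooth_on S f" "p \<in> S"
  shows "(f has_real_derivative deriv f p) (at p)"
  using smooth_on_imp_differentiable[OF assms] real_differentiableE DERIV_imp_deriv by metis

text \<open>The second difference of \<open>g\<close> over the parallelogram spanned by h a and h b
  is symmetric in a and b. Two applications of the mean value theorem equate it with h^2 times a
  mixed derivative at a nearby point, in either order; continuity of the mixed derivatives concludes
  as the parallelogram shrinks.\<close>

lemma symmetric_second_derivative_real:
  fixes g :: "'a::real_normed_vector \<Rightarrow> real"
  assumes S: "open S" "z \<in> S" and g: "smooth_on S g"
  shows "frechet_derivative (\<lambda>p. frechet_derivative g (at p) a) (at z) b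
    = frechet_derivative (\<lambda>p. frechet_derivative g (at p) b) (at z) a"
proof -
  define G where "G a b p = frechet_derivative (\<lambda>p. frechet_derivative g (at p) a) (at p) b" for a b p
  have cont: "isCont (G a b) z" for a b
    using smooth_on_imp_continuous_on[OF smooth_on_frechet_derivative[OF smooth_on_frechet_derivative[OF g]]]
      S unfolding G_def by (simp add: continuous_on_eq_continuous_at)
  have ex: "\<exists>p. norm (p - z) \<le> h * (norm a + norm b) \<and>
      g (z + h *\<^sub>R a + h *\<^sub>R b) - g (z + h *\<^sub>R a) - (g (z + h *\<^sub>R b) - g z) = h * h * G a b p"
    if "0 < h" "cball z (h * (norm a + norm b)) \<subseteq> S" for h a b
  proof -
    have bound: "norm (s *\<^sub>R a + r *\<^sub>R b) \<le> h * (norm a + norm b)"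
      if "0 \<le> s" "s \<le> h" "0 \<le> r" "r \<le> h" for s r
      using that by (intro order_trans[OF norm_triangle_ineq])
        (auto simp: distrib_left intro!: add_mono mult_right_mono)
    have inS: "z + s *\<^sub>R a + r *\<^sub>R b \<in> S" if "0 \<le> s" "s \<le> h" "0 \<le> r" "r \<le> h" for s r
    proof -
      have "z + (s *\<^sub>R a + r *\<^sub>R b) \<in> cball z (h * (norm a + norm b))"
        using bound[OF that] norm_minus_cancel[of "s *\<^sub>R a + r *\<^sub>R b"]
        by (simp only: mem_cball dist_norm) simp
      then show ?thesis
        using \<open>cball z (h * (norm a + norm b)) \<subseteq> S\<close> by (auto simp: algebra_simps)
    qed
    have D1: "((\<lambda>s. F (w + s *\<^sub>R u)) has_real_derivative frechet_derivative F (at (w + s *\<^sub>R u)) u) (at s)"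
      if "smooth_on S F" "w + s *\<^sub>R u \<in> S" for F :: "'a \<Rightarrow> real" and w u s
    proof -
      have F: "(F has_derivative frechet_derivative F (at (w + s *\<^sub>R u))) (at (w + s *\<^sub>R u))"
        using that by (rule smooth_on_imp_has_derivative)
      have "((\<lambda>s. F (w + s *\<^sub>R u)) has_derivative
          (\<lambda>r. frechet_derivative F (at (w + s *\<^sub>R u)) (r *\<^sub>R u))) (at s)"
        by (rule has_derivative_compose[where g = F and f = "\<lambda>s. w + s *\<^sub>R u", OF _ F]) (auto intro!: derivative_eq_intros)
      then show ?thesis
        unfolding has_field_derivative_def
        using linear_cmul[OF has_derivative_linear[OF F]] by (simp add: mult_commute_abs)
    qed
    \<comment> \<open>The second difference is the increment of \<open>P\<close> over [0, h]; the
      mean value theorem in direction a, and then for \<open>Q\<close> in direction b, yields the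
      mixed derivative.\<close>
    define P where "P s = g (z + s *\<^sub>R a + h *\<^sub>R b) - g (z + s *\<^sub>R a)" for s
    have P: "(P has_real_derivative frechet_derivative g (at (z + s *\<^sub>R a + h *\<^sub>R b)) a
        - frechet_derivative g (at (z + s *\<^sub>R a)) a) (at s)" if "0 \<le> s" "s \<le> h" for s
      unfolding P_def
      using D1[OF g, of "z + h *\<^sub>R b" s a] D1[OF g, of z s a] inS[OF that, of h] inS[OF that, of 0] \<open>0 < h\<close>
      by (intro DERIV_diff) (auto simp: algebra_simps)
    obtain s where s: "0 < s" "s < h" and
      Ps: "P h - P 0 = (h - 0) * (frechet_derivative g (at (z + s *\<^sub>R a + h *\<^sub>R b)) a
        - frechet_derivative g (at (z + s *\<^sub>R a)) a)"
      using MVT2[of 0 h P "\<lambda>s. frechet_derivative g (at (z + s *\<^sub>R a + h *\<^sub>R b)) a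
        - frechet_derivative g (at (z + s *\<^sub>R a)) a", OF \<open>0 < h\<close> P] by auto
    define Q where "Q r = frechet_derivative g (at (z + s *\<^sub>R a + r *\<^sub>R b)) a" for r
    have Q: "(Q has_real_derivative G a b (z + s *\<^sub>R a + r *\<^sub>R b)) (at r)" if "0 \<le> r" "r \<le> h" for r
      unfolding Q_def G_def
      using D1[OF smooth_on_frechet_derivative[OF g], of "z + s *\<^sub>R a" r b a] inS[of s r] s that by auto
    obtain r where r: "0 < r" "r < h" and
      Qr: "Q h - Q 0 = (h - 0) * G a b (z + s *\<^sub>R a + r *\<^sub>R b)"
      using MVT2[of 0 h Q "\<lambda>r. G a b (z + s *\<^sub>R a + r *\<^sub>R b)", OF \<open>0 < h\<close> Q] by auto
    have "norm (z + s *\<^sub>R a + r *\<^sub>R b - z) \<le> h * (norm a + norm b)"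
      using bound[of s r] s r by (simp add: algebra_simps)
    moreover have "g (z + h *\<^sub>R a + h *\<^sub>R b) - g (z + h *\<^sub>R a) - (g (z + h *\<^sub>R b) - g z) =
        h * h * G a b (z + s *\<^sub>R a + r *\<^sub>R b)"
      using Ps Qr unfolding P_def Q_def by simp
    ultimately show ?thesis by blast
  qed
  have "\<bar>G a b z - G b a z\<bar> < e" if "e > 0" for e
  proof -
    have "\<exists>d>0. \<forall>p. dist p z < d \<longrightarrow> dist (G a b p) (G a b z) < e / 2" for a b
      using cont[of a b] half_gt_zero[OF \<open>e > 0\<close>] unfolding continuous_at_eps_delta by blast
    then obtain d1 d2 where d: "d1 > 0" "d2 > 0"
      "\<And>p. dist p z < d1 \<Longrightarrow> dist (G a b p) (G a b z) < e / 2"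
      "\<And>p. dist p z < d2 \<Longrightarrow> dist (G b a p) (G b a z) < e / 2"
      by metis
    obtain r where r: "r > 0" "cball z r \<subseteq> S"
      using S open_contains_cball by blast
    \<comment> \<open>The summand 1 keeps the divisor positive when a = b = 0. The resulting
      \<open>h\<close> puts the whole parallelogram inside \<open>S\<close> and inside both
      continuity radii.\<close>
    define N where "N = norm a + norm b + 1"
    define h where "h = Min {d1, d2, r} / (2 * N)"
    have N: "N > 0" "norm a + norm b < N" unfolding N_def using norm_ge_zero[of a] norm_ge_zero[of b] by linarith+
    have h: "h > 0" using d r N unfolding h_def by auto
    have hN: "h * (norm a + norm b) < Min {d1, d2, r}"
    proof -
      have "h * (norm a + norm b) < h * N" using N h by simp
      also have "\<dots> = Min {d1, d2, r} / 2" unfolding h_def using N by simp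
      also have "\<dots> < Min {d1, d2, r}" using d(1,2) r(1) by (simp add: min_def)
      finally show ?thesis .
    qed
    then have sub: "cball z (h * (norm a + norm b)) \<subseteq> S"
      using r by (auto simp: subset_iff)
    obtain p where p: "norm (p - z) \<le> h * (norm a + norm b)"
      "g (z + h *\<^sub>R a + h *\<^sub>R b) - g (z + h *\<^sub>R a) - (g (z + h *\<^sub>R b) - g z) = h * h * G a b p"
      using ex[OF h sub] by blast
    obtain q where q: "norm (q - z) \<le> h * (norm a + norm b)"
      "g (z + h *\<^sub>R b + h *\<^sub>R a) - g (z + h *\<^sub>R b) - (g (z + h *\<^sub>R a) - g z) = h * h * G b a q"
      using ex[OF h, of b a] sub by (auto simp: add.commute)
    have "h * h * G a b p = h * h * G b a q"
      using p(2) q(2) by (simp add: algebra_simps)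
    then have "G a b p = G b a q" using h by simp
    moreover have "dist (G a b p) (G a b z) < e / 2" "dist (G b a q) (G b a z) < e / 2"
      using p(1) q(1) hN d(3,4) by (auto simp: dist_norm)
    ultimately show ?thesis unfolding dist_real_def by linarith
  qed
  then have "G a b z = G b a z"
    by (metis abs_not_less_zero eq_iff_diff_eq_0 less_irrefl zero_less_abs_iff)
  then show ?thesis unfolding G_def .
qed

text \<open>Reduces to the scalar case by testing against every vector w of the inner product
  space.\<close>

lemma symmetric_second_derivative:
  fixes g :: "'a::real_normed_vector \<Rightarrow> 'b::real_inner"
  assumes S: "open S" "z \<in> S" and g: "smooth_on S g"
  shows "frechet_derivative (\<lambda>p. frechet_derivative g (at p) a) (at z) b
    = frechet_derivative (\<lambda>p. frechet_derivative g (at p) b) (at z) a"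
proof -
  have inner: "frechet_derivative (\<lambda>p. F p \<bullet> w) (at p) = (\<lambda>v. frechet_derivative F (at p) v \<bullet> w)"
    if "smooth_on S F" "p \<in> S" for F :: "'a \<Rightarrow> 'b" and w p
    using smooth_on_imp_has_derivative[OF that]
    by (intro frechet_derivative_at[symmetric] bounded_linear.has_derivative[OF bounded_linear_inner_left])
  have eq: "frechet_derivative (\<lambda>p. frechet_derivative (\<lambda>p. g p \<bullet> w) (at p) a) (at z) b
      = frechet_derivative (\<lambda>p. frechet_derivative g (at p) a) (at z) b \<bullet> w" for a b w
    using frechet_derivative_cong_open[OF S, of "\<lambda>p. frechet_derivative (\<lambda>p. g p \<bullet> w) (at p) a"
        "\<lambda>p. frechet_derivative g (at p) a \<bullet> w"]
      inner[OF g] inner[OF smooth_on_frechet_derivative[OF g] S(2)] by simp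
  have "smooth_on S (\<lambda>p. g p \<bullet> w)" for w
    using S(1) bounded_linear_inner_left g by (rule smooth_on_bounded_linear)
  then show ?thesis
    using symmetric_second_derivative_real[OF S, of "\<lambda>p. g p \<bullet> _" a b]
    unfolding eq by (metis (no_types) vector_eq_rdot)
qed

section \<open>The Robertson-Walker metric and its connection\<close>

lemma bounded_bilinear_space_form_metric: "bounded_bilinear (space_form_metric c)"
proof -
  have 1: "bounded_bilinear (\<lambda>(v :: real \<times> (real^3)) (w :: real \<times> (real^3)). c * fst v * fst w)"
    using bounded_bilinear.comp[OF bounded_bilinear_mult
        bounded_linear_compose[OF bounded_linear_mult_right[of c] bounded_linear_fst] bounded_linear_fst]
    by simp
  have 2: "bounded_bilinear (\<lambda>(v :: real \<times> (real^3)) (w :: real \<times> (real^3)). snd v \<bullet> snd w)"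
    by (rule bounded_bilinear.comp[OF bounded_bilinear_inner bounded_linear_snd bounded_linear_snd])
  obtain K1 where K1: "\<And>(v :: real \<times> (real^3)) (w :: real \<times> (real^3)). norm (c * fst v * fst w) \<le> norm v * norm w * K1"
    using bounded_bilinear.bounded[OF 1] by blast
  obtain K2 where K2: "\<And>(v :: real \<times> (real^3)) (w :: real \<times> (real^3)). norm (snd v \<bullet> snd w) \<le> norm v * norm w * K2"
    using bounded_bilinear.bounded[OF 2] by blast
  show ?thesis
  proof
    show "\<exists>K. \<forall>v w. norm (space_form_metric c v w) \<le> norm v * norm w * K"
    proof (intro exI allI)
      show "norm (space_form_metric c v w) \<le> norm v * norm w * (K1 + K2)" for v w
        unfolding space_form_metric_def distrib_left
        using K1[of v w] K2[of v w] norm_triangle_ineq[of "c * fst v * fst w" "snd v \<bullet> snd w"]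
        by linarith
    qed
  qed (auto simp: space_form_metric_def algebra_simps)
qed

interpretation sfm: bounded_bilinear "space_form_metric c" for c
  by (rule bounded_bilinear_space_form_metric)

lemmas sfm_simps = sfm.add_left sfm.add_right sfm.diff_left sfm.diff_right sfm.minus_left
  sfm.minus_right sfm.scaleR_left sfm.scaleR_right sfm.zero_left sfm.zero_right

lemma sfm_commute: "space_form_metric c v w = space_form_metric c w v"
  by (simp add: space_form_metric_def inner_commute algebra_simps)

lemma rw_metric_commute: "rw_metric f c p v w = rw_metric f c p w v"
  by (simp add: rw_metric_def sfm_commute mult.commute)

lemma rw_metric_simps:
  "rw_metric f c p (v + v') w = rw_metric f c p v w + rw_metric f c p v' w"
  "rw_metric f c p v (w + w') = rw_metric f c p v w + rw_metric f c p v w'"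
  "rw_metric f c p (v - v') w = rw_metric f c p v w - rw_metric f c p v' w"
  "rw_metric f c p v (w - w') = rw_metric f c p v w - rw_metric f c p v w'"
  "rw_metric f c p (- v) w = - rw_metric f c p v w"
  "rw_metric f c p v (- w) = - rw_metric f c p v w"
  "rw_metric f c p (a *\<^sub>R v) w = a * rw_metric f c p v w"
  "rw_metric f c p v (a *\<^sub>R w) = a * rw_metric f c p v w"
  "rw_metric f c p 0 w = 0"
  "rw_metric f c p v 0 = 0"
  by (simp_all add: rw_metric_def sfm_simps algebra_simps)

lemma subspace_rw_tangent: "subspace (rw_tangent c p)"
proof -
  have "rw_tangent c p = {v. (0, fst (snd p), c *\<^sub>R snd (snd p)) \<bullet> v = 0}"
    by (auto simp: rw_tangent_def inner_prod_def)
  then show ?thesis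
    by (simp add: subspace_hyperplane)
qed

lemma partial_t_tangent: "partial_t \<in> rw_tangent c p"
  by (simp add: rw_tangent_def partial_t_def)

lemma rw_metric_partial_t: "rw_metric f c p v partial_t = - fst v"
  by (simp add: rw_metric_def partial_t_def sfm_simps flip: zero_prod_def)

lemma dim_rw_tangent:
  assumes "p \<in> rw_space I c"
  shows "dim (rw_tangent c p) = 4"
proof -
  \<comment> \<open>Half the Euclidean gradient of s^2 + c |y|^2. Its product with (0, s, y) is 1,
    so it is nonzero and its orthogonal complement has codimension 1 in the 5-dimensional ambient
    space.\<close>
  define N where "N = (0 :: real, fst (snd p), c *\<^sub>R snd (snd p))"
  have "N \<noteq> 0"
    using assms by (auto simp: N_def rw_space_def space_form_def zero_prod_def)
  moreover have "rw_tangent c p = {v. N \<bullet> v = 0}"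
    by (auto simp: rw_tangent_def N_def inner_prod_def)
  ultimately show ?thesis
    using dim_hyperplane[of N] by simp
qed

text \<open>
  The position vector is normal to the space form only if \<open>c \<noteq> 0\<close>; the factor \<open>c\<close> makes the statement
  uniform.
\<close>

lemma sfm_position_tangent:
  assumes "c \<in> {-1, 0, 1}" "w \<in> rw_tangent c p"
  shows "c * space_form_metric c (snd p) (snd w) = 0"
proof -
  have "c * space_form_metric c (snd p) (snd w) =
      (c * c) * (fst (snd p) * fst (snd w)) + c * (snd (snd p) \<bullet> snd (snd w))"
    by (simp add: space_form_metric_def algebra_simps)
  also have "\<dots> = 0"
    using assms by (auto simp: rw_tangent_def)
  finally show ?thesis .
qed

text \<open>Testing against d/dt kills the time component. For c \<noteq> 0, z is also orthogonal to
  the position vector, hence to the whole ambient space of the space form, where the metric is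
  nondegenerate. For c = 0 the ambient metric ignores s, but tangency already forces the s-component
  to vanish.\<close>

lemma rw_metric_nondegenerate:
  assumes c: "c \<in> {-1, 0, 1}" and p: "p \<in> rw_space I c" and f: "f (fst p) \<noteq> 0"
    and z: "z \<in> rw_tangent c p"
    and orth: "\<And>w. w \<in> rw_tangent c p \<Longrightarrow> rw_metric f c p z w = 0"
  shows "z = 0"
proof -
  have z0: "fst z = 0"
    using orth[OF partial_t_tangent] by (simp add: rw_metric_partial_t)
  have sp: "space_form_metric c (snd z) (snd w) = 0" if "w \<in> rw_tangent c p" for w
    using orth[OF that] z0 f by (simp add: rw_metric_def)
  have p1: "(fst (snd p))\<^sup>2 + c * (snd (snd p) \<bullet> snd (snd p)) = 1" "c \<le> 0 \<Longrightarrow> fst (snd p) > 0"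
    using p by (auto simp: rw_space_def space_form_def)
  have all: "space_form_metric c (snd z) u = 0" if "c \<noteq> 0" for u
  proof -
    \<comment> \<open>The coefficient of the position vector in u: subtracting k times the position
      makes u tangent, because the position satisfies the equation s^2 + c |y|^2 = 1.\<close>
    define k where "k = fst (snd p) * fst u + c * (snd (snd p) \<bullet> snd u)"
    have "k * (fst (snd p))\<^sup>2 + c * (k * (snd (snd p) \<bullet> snd (snd p))) = k"
      using arg_cong[OF p1(1), of "\<lambda>y. k * y"] by (simp add: algebra_simps)
    then have "(0, u - k *\<^sub>R snd p) \<in> rw_tangent c p"
      by (simp add: rw_tangent_def k_def inner_diff_right algebra_simps power2_eq_square)
    from sp[OF this] have "space_form_metric c (snd z) u = k * space_form_metric c (snd z) (snd p)"
      by (simp add: sfm_simps)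
    then show ?thesis
      using sfm_position_tangent[OF c z] that by (simp add: sfm_commute)
  qed
  have "snd z = 0"
  proof (cases "c = 0")
    case True
    then have "fst (snd z) = 0"
      using z p1 by (simp add: rw_tangent_def)
    moreover have "snd (snd z) \<bullet> snd (snd z) = 0"
      using sp[OF z] True by (simp add: space_form_metric_def)
    ultimately show ?thesis by (simp add: prod_eq_iff)
  next
    case False
    have "snd (snd z) \<bullet> snd (snd z) = 0" "fst (snd z) = 0"
      using all[OF False, of "(0, snd (snd z))"] all[OF False, of "(1, 0)"] False
      by (simp_all add: space_form_metric_def)
    then show ?thesis by (simp add: prod_eq_iff)
  qed
  then show ?thesis using z0 by (simp add: prod_eq_iff)
qed

text \<open>The Levi-Civita connection of the warped product in closed form. The terms with f' are
  its Christoffel terms; the last term is the Gauss formula of the sphere or hyperboloid, removing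
  the normal component of the ambient derivative, and it disappears for c = 0.\<close>

definition rw_conn :: "(real \<Rightarrow> real) \<Rightarrow> real \<Rightarrow> amb \<Rightarrow> amb \<Rightarrow> amb \<Rightarrow> amb \<Rightarrow> amb" where
  "rw_conn f c p u v v' =
     (fst v' + f (fst p) * deriv f (fst p) * space_form_metric c (snd u) (snd v),
      snd v' + (deriv f (fst p) / f (fst p)) *\<^sub>R (fst u *\<^sub>R snd v + fst v *\<^sub>R snd u)
        + (c * space_form_metric c (snd u) (snd v)) *\<^sub>R snd p)"

text \<open>The only point-dependent coefficient of the metric is f(t)^2, so every derivative in the
  Koszul term is 2 f f' times the time component of its direction.\<close>

lemma koszul_term_eq:
  assumes "(f has_real_derivative f') (at (fst p))"
  shows "koszul_term f c p u v w = f (fst p) * f' *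
    (fst u * space_form_metric c (snd v) (snd w) + fst v * space_form_metric c (snd u) (snd w)
     - fst w * space_form_metric c (snd u) (snd v))"
proof -
  have f: "((\<lambda>q. f (fst q)) has_derivative (\<lambda>a. f' * fst a)) (at p)"
    by (rule has_derivative_compose[of fst fst p UNIV f "\<lambda>a. f' * a"])
      (use assms in \<open>auto intro: derivative_eq_intros simp: has_field_derivative_def\<close>)
  have "((\<lambda>q. rw_metric f c q v w) has_derivative
      (\<lambda>a. 2 * f (fst p) * f' * fst a * space_form_metric c (snd v) (snd w))) (at p)" for v w
    unfolding rw_metric_def by (rule derivative_eq_intros f refl | simp add: fun_eq_iff)+
  then have "frechet_derivative (\<lambda>q. rw_metric f c q v w) (at p) =
      (\<lambda>a. 2 * f (fst p) * f' * fst a * space_form_metric c (snd v) (snd w))" for v w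
    by (rule frechet_derivative_at[symmetric])
  then show ?thesis
    unfolding koszul_term_def by (simp add: field_simps)
qed

text \<open>The premise on \<open>v'\<close> is the derivative of the tangency condition for a field with value \<open>v\<close>.\<close>

lemma rw_conn_tangent:
  assumes c: "c \<in> {-1, 0, 1}" and p: "p \<in> rw_space I c"
    and u: "u \<in> rw_tangent c p" and v: "v \<in> rw_tangent c p"
    and v': "fst (snd p) * fst (snd v') + c * (snd (snd p) \<bullet> snd (snd v')) =
      - (fst (snd u) * fst (snd v) + c * (snd (snd u) \<bullet> snd (snd v)))"
  shows "rw_conn f c p u v v' \<in> rw_tangent c p"
proof -
  define k where "k = c * space_form_metric c (snd u) (snd v)"
  \<comment> \<open>For c \<noteq> 0 this is c * c = 1. For c = 0 the left side is zero, and on the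
    right tangency at a point with s > 0 makes the s-components vanish.\<close>
  have k: "k = fst (snd u) * fst (snd v) + c * (snd (snd u) \<bullet> snd (snd v))"
  proof (cases "c = 0")
    case True
    then show ?thesis
      using u p by (simp add: k_def rw_tangent_def rw_space_def space_form_def split: prod.splits) auto
  next
    case False
    then have "c * c = 1" using c by auto
    moreover have "k = (c * c) * (fst (snd u) * fst (snd v)) + c * (snd (snd u) \<bullet> snd (snd v))"
      by (simp add: k_def space_form_metric_def algebra_simps)
    ultimately show ?thesis by simp
  qed
  have p1: "fst (snd p) * fst (snd p) + c * (snd (snd p) \<bullet> snd (snd p)) = 1"
    using p by (auto simp: rw_space_def space_form_def power2_eq_square)
  define F where "F = deriv f (fst p) / f (fst p)"
  have "fst (snd p) * fst (snd (rw_conn f c p u v v')) + c * (snd (snd p) \<bullet> snd (snd (rw_conn f c p u v v')))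
      = (fst (snd p) * fst (snd v') + c * (snd (snd p) \<bullet> snd (snd v')))
        + F * (fst u * (fst (snd p) * fst (snd v) + c * (snd (snd p) \<bullet> snd (snd v)))
          + fst v * (fst (snd p) * fst (snd u) + c * (snd (snd p) \<bullet> snd (snd u))))
        + k * (fst (snd p) * fst (snd p) + c * (snd (snd p) \<bullet> snd (snd p)))"
    unfolding rw_conn_def F_def[symmetric] k_def[symmetric] by (simp add: inner_add_right algebra_simps)
  also have "\<dots> = 0"
    unfolding v' p1 using u v k by (simp add: rw_tangent_def)
  finally show ?thesis by (simp add: rw_tangent_def)
qed

text \<open>Replaces a definite description by an expression that can be differentiated again. The
  position term of \<open>rw_conn\<close> pairs to zero with tangent vectors, which gives the Koszul
  identity; nondegeneracy gives uniqueness.\<close>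

lemma rw_cov_eq_rw_conn:
  assumes c: "c \<in> {-1, 0, 1}" and p: "p \<in> rw_space I c"
    and f: "(f has_real_derivative deriv f (fst p)) (at (fst p))" "f (fst p) \<noteq> 0"
    and u: "u \<in> rw_tangent c p" and v: "v \<in> rw_tangent c p"
    and v': "fst (snd p) * fst (snd v') + c * (snd (snd p) \<bullet> snd (snd v')) =
      - (fst (snd u) * fst (snd v) + c * (snd (snd u) \<bullet> snd (snd v)))"
  shows "rw_cov f c p u v v' = rw_conn f c p u v v'"
  unfolding rw_cov_def
proof (rule the_equality)
  let ?C = "rw_conn f c p u v v'"
  have tan: "?C \<in> rw_tangent c p"
    by (rule rw_conn_tangent[OF c p u v v'])
  moreover have eq: "rw_metric f c p ?C w = rw_metric f c p v' w + koszul_term f c p u v w"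
    if w: "w \<in> rw_tangent c p" for w
  proof -
    have "c = 0 \<or> space_form_metric c (snd p) (snd w) = 0"
      using sfm_position_tangent[OF c w] by auto
    then show ?thesis
      unfolding koszul_term_eq[OF f(1)] rw_metric_def rw_conn_def using f(2)
      by (auto simp: sfm_simps algebra_simps power2_eq_square)
  qed
  ultimately show "?C \<in> rw_tangent c p \<and>
      (\<forall>w\<in>rw_tangent c p. rw_metric f c p ?C w = rw_metric f c p v' w + koszul_term f c p u v w)"
    by blast
  fix z
  assume z: "z \<in> rw_tangent c p \<and>
      (\<forall>w\<in>rw_tangent c p. rw_metric f c p z w = rw_metric f c p v' w + koszul_term f c p u v w)"
  have "z - ?C = 0"
    by (rule rw_metric_nondegenerate[where f=f, OF c p f(2)])
      (use z tan eq subspace_diff[OF subspace_rw_tangent] in \<open>auto simp: rw_metric_simps\<close>)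
  then show "z = ?C" by simp
qed

section \<open>Fields along a parametrized patch\<close>

text \<open>The parameter space is an arbitrary Euclidean space and no immersion is assumed, so that
  the same calculus serves curves (in the definition of totally geodesic hypersurfaces) and charts
  of surfaces.\<close>

locale rw_patch =
  fixes f :: "real \<Rightarrow> real" and c :: real and I :: "real set"
    and \<Omega> :: "'a::euclidean_space set" and r :: "'a \<Rightarrow> amb"
  assumes c: "c \<in> {-1, 0, 1}"
    and I: "open I" and f: "smooth_on I f" and f_nz: "\<And>t. t \<in> I \<Longrightarrow> f t \<noteq> 0"
    and \<Omega>: "open \<Omega>" and r: "smooth_on \<Omega> r" and r_space: "\<And>z. z \<in> \<Omega> \<Longrightarrow> r z \<in> rw_space I c"
begin

abbreviation d :: "('a \<Rightarrow> 'b::real_normed_vector) \<Rightarrow> 'a \<Rightarrow> 'a \<Rightarrow> 'b" where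
  "d F a z \<equiv> frechet_derivative F (at z) a"

definition rw_field :: "('a \<Rightarrow> amb) \<Rightarrow> bool" where
  "rw_field V \<longleftrightarrow> smooth_on \<Omega> V \<and> (\<forall>z\<in>\<Omega>. V z \<in> rw_tangent c (r z))"

text \<open>The direction is a constant vector of the parameter space: coordinate fields commute, so
  torsion-freeness and curvature take their bracket-free form.\<close>

definition cov :: "'a \<Rightarrow> ('a \<Rightarrow> amb) \<Rightarrow> 'a \<Rightarrow> amb" where
  "cov a V z = rw_conn f c (r z) (d r a z) (V z) (d V a z)"

abbreviation g :: "'a \<Rightarrow> amb \<Rightarrow> amb \<Rightarrow> real" where
  "g z \<equiv> rw_metric f c (r z)"

section \<open>Calculus of fields along the patch\<close>

lemma time_in: "z \<in> \<Omega> \<Longrightarrow> fst (r z) \<in> I"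
  using r_space by (auto simp: rw_space_def mem_Times_iff)

lemma f_nz': "z \<in> \<Omega> \<Longrightarrow> f (fst (r z)) \<noteq> 0"
  using f_nz time_in by blast

lemma DERIV_f: "z \<in> \<Omega> \<Longrightarrow> (f has_real_derivative deriv f (fst (r z))) (at (fst (r z)))"
  using smooth_on_imp_DERIV[OF f] time_in by blast

lemma smooth_f: "smooth_on \<Omega> (\<lambda>z. f (fst (r z)))"
  by (rule smooth_on_compose_real[OF \<Omega> f smooth_on_fst[OF \<Omega> r]]) (use time_in in auto)

lemma smooth_deriv_f: "smooth_on \<Omega> (\<lambda>z. deriv f (fst (r z)))"
  by (rule smooth_on_compose_real[OF \<Omega> smooth_on_deriv[OF I f] smooth_on_fst[OF \<Omega> r]])
    (use time_in in auto)

lemma rw_field_smooth: "rw_field V \<Longrightarrow> smooth_on \<Omega> V"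
  by (simp add: rw_field_def)

lemma rw_field_tangent: "rw_field V \<Longrightarrow> z \<in> \<Omega> \<Longrightarrow> V z \<in> rw_tangent c (r z)"
  by (simp add: rw_field_def)

lemma has_derivative_d: "smooth_on \<Omega> F \<Longrightarrow> z \<in> \<Omega> \<Longrightarrow> (F has_derivative (\<lambda>a. d F a z)) (at z)"
  by (rule smooth_on_imp_has_derivative)

lemma linear_d: "smooth_on \<Omega> F \<Longrightarrow> z \<in> \<Omega> \<Longrightarrow> linear (\<lambda>a. d F a z)"
  using has_derivative_d has_derivative_linear by blast

lemma d_eqI: "(F has_derivative D) (at z) \<Longrightarrow> d F a z = D a"
  by (metis frechet_derivative_at)

text \<open>Obtained by differentiating the tangency equation along the patch; it is exactly the
  premise under which \<open>rw_conn\<close> is tangent and equals \<open>rw_cov\<close>.\<close>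

lemma d_tangent:
  assumes "rw_field V" "z \<in> \<Omega>"
  shows "fst (snd (r z)) * fst (snd (d V a z)) + c * (snd (snd (r z)) \<bullet> snd (snd (d V a z))) =
      - (fst (snd (d r a z)) * fst (snd (V z)) + c * (snd (snd (d r a z)) \<bullet> snd (snd (V z))))"
proof -
  let ?P = "\<lambda>z. fst (snd (r z)) * fst (snd (V z)) + c * (snd (snd (r z)) \<bullet> snd (snd (V z)))"
  have "d ?P a z = d (\<lambda>_. 0 :: real) a z"
    using frechet_derivative_cong_open[OF \<Omega> assms(2), of ?P "\<lambda>_. 0"] rw_field_tangent[OF assms(1)]
    by (simp add: rw_tangent_def)
  moreover
  have "(?P has_derivative (\<lambda>a. fst (snd (r z)) * fst (snd (d V a z)) + fst (snd (d r a z)) * fst (snd (V z))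
      + c * (snd (snd (r z)) \<bullet> snd (snd (d V a z)) + snd (snd (d r a z)) \<bullet> snd (snd (V z))))) (at z)"
    by (rule derivative_eq_intros has_derivative_d[OF r assms(2)] refl
        has_derivative_d[OF rw_field_smooth[OF assms(1)] assms(2)] | simp)+
  note d_eqI[OF this, of a]
  ultimately have "fst (snd (r z)) * fst (snd (d V a z)) + fst (snd (d r a z)) * fst (snd (V z))
      + c * (snd (snd (r z)) \<bullet> snd (snd (d V a z)) + snd (snd (d r a z)) \<bullet> snd (snd (V z))) = 0"
    by simp
  then show ?thesis
    by (simp add: algebra_simps)
qed

lemma rw_field_dr: "rw_field (d r a)"
proof -
  have "fst (snd (r z)) * fst (snd (d r a z)) + c * (snd (snd (r z)) \<bullet> snd (snd (d r a z))) = 0"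
    if z: "z \<in> \<Omega>" for z
  proof -
    let ?P = "\<lambda>z. fst (snd (r z)) * fst (snd (r z)) + c * (snd (snd (r z)) \<bullet> snd (snd (r z)))"
    have "?P w = 1" if "w \<in> \<Omega>" for w
      using r_space[OF that] by (auto simp: rw_space_def space_form_def power2_eq_square)
    then have "d ?P a z = d (\<lambda>_. 1 :: real) a z"
      using frechet_derivative_cong_open[OF \<Omega> z, of ?P "\<lambda>_. 1"] by simp
    moreover have "(?P has_derivative (\<lambda>a. 2 * (fst (snd (r z)) * fst (snd (d r a z)))
        + c * (2 * (snd (snd (r z)) \<bullet> snd (snd (d r a z)))))) (at z)"
      by (rule derivative_eq_intros has_derivative_d[OF r z] refl | simp add: inner_commute fun_eq_iff)+
    ultimately show ?thesis
      using d_eqI[of ?P _ z a] by simp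
  qed
  then show ?thesis
    by (simp add: rw_field_def rw_tangent_def smooth_on_frechet_derivative[OF r])
qed

lemma dr_tangent: "z \<in> \<Omega> \<Longrightarrow> d r a z \<in> rw_tangent c (r z)"
  using rw_field_dr rw_field_tangent by blast

lemma rw_cov_eq_cov:
  assumes "rw_field V" "z \<in> \<Omega>"
  shows "rw_cov f c (r z) (d r a z) (V z) (d V a z) = cov a V z"
  unfolding cov_def
  using rw_cov_eq_rw_conn[OF c r_space[OF assms(2)] DERIV_f[OF assms(2)] f_nz'[OF assms(2)]
      dr_tangent[OF assms(2)] rw_field_tangent[OF assms] d_tangent[OF assms]] .

lemma rw_field_cov:
  assumes "rw_field V"
  shows "rw_field (cov a V)"
proof -
  have "cov a V z \<in> rw_tangent c (r z)" if "z \<in> \<Omega>" for z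
    unfolding cov_def
    by (rule rw_conn_tangent[OF c r_space dr_tangent rw_field_tangent[OF assms] d_tangent[OF assms]])
      (rule that)+
  moreover have "smooth_on \<Omega> (cov a V)"
    unfolding cov_def rw_conn_def
    using \<Omega> f_nz'
    by (intro smooth_on_Pair smooth_on_add smooth_on_mult smooth_on_scaleR smooth_on_divide
        smooth_on_bilinear[OF _ bounded_bilinear_space_form_metric] smooth_on_fst smooth_on_snd
        smooth_f smooth_deriv_f smooth_on_const smooth_on_frechet_derivative r
        rw_field_smooth[OF assms]) auto
  ultimately show ?thesis
    by (simp add: rw_field_def)
qed

lemma smooth_metric:
  assumes "smooth_on \<Omega> V" "smooth_on \<Omega> W"
  shows "smooth_on \<Omega> (\<lambda>z. g z (V z) (W z))"
  unfolding rw_metric_def power2_eq_square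
  using \<Omega> by (intro smooth_on_add smooth_on_uminus smooth_on_mult smooth_f
      smooth_on_bilinear[OF _ bounded_bilinear_space_form_metric] smooth_on_fst smooth_on_snd assms)

lemma has_derivative_f:
  "z \<in> \<Omega> \<Longrightarrow> ((\<lambda>z. f (fst (r z))) has_derivative (\<lambda>a. deriv f (fst (r z)) * fst (d r a z))) (at z)"
  by (rule has_derivative_compose[of "\<lambda>z. fst (r z)" "\<lambda>a. fst (d r a z)" z UNIV f])
    (use DERIV_f has_derivative_d[OF r] in
      \<open>auto intro!: has_derivative_fst simp: has_field_derivative_def\<close>)

text \<open>The derivative of f^2 is matched by the terms of \<open>rw_conn\<close> with f', and the
  position terms drop out because c times the product of the position with a tangent vector is
  zero.\<close>

lemma metric_compatible:
  assumes V: "rw_field V" and W: "rw_field W" and z: "z \<in> \<Omega>"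
  shows "d (\<lambda>z. g z (V z) (W z)) a z = g z (cov a V z) (W z) + g z (V z) (cov a W z)"
proof -
  let ?S = "space_form_metric c"
  let ?t = "fst (r z)" and ?p = "snd (r z)"
  have "((\<lambda>z. g z (V z) (W z)) has_derivative
     (\<lambda>a. - (fst (V z) * fst (d W a z) + fst (d V a z) * fst (W z))
        + ((f ?t)\<^sup>2 * (?S (snd (V z)) (snd (d W a z)) + ?S (snd (d V a z)) (snd (W z)))
           + (2 * f ?t * (deriv f ?t * fst (d r a z))) * ?S (snd (V z)) (snd (W z))))) (at z)"
    unfolding rw_metric_def
    by (rule derivative_eq_intros has_derivative_f[OF z] has_derivative_d[OF rw_field_smooth[OF V] z]
        has_derivative_d[OF rw_field_smooth[OF W] z] sfm.FDERIV refl | simp add: fun_eq_iff)+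
  note D = d_eqI[OF this, of a]
  have "c = 0 \<or> ?S ?p (snd (V z)) = 0" "c = 0 \<or> ?S ?p (snd (W z)) = 0"
    using sfm_position_tangent[OF c] rw_field_tangent[OF V z] rw_field_tangent[OF W z]
    by (metis mult_eq_0_iff)+
  then show ?thesis
    unfolding D unfolding cov_def rw_conn_def rw_metric_def using f_nz'[OF z]
    by (auto simp: sfm_simps algebra_simps power2_eq_square sfm_commute)
qed

lemma metric_compatible_orthogonal:
  assumes "rw_field V" "rw_field W" "z \<in> \<Omega>" "\<And>w. w \<in> \<Omega> \<Longrightarrow> g w (V w) (W w) = k"
  shows "g z (cov a V z) (W z) = - g z (V z) (cov a W z)"
proof -
  have "d (\<lambda>z. g z (V z) (W z)) a z = d (\<lambda>_. k) a z"
    using frechet_derivative_cong_open[OF \<Omega> assms(3), of "\<lambda>z. g z (V z) (W z)" "\<lambda>_. k"] assms(4)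
    by simp
  then show ?thesis
    using metric_compatible[OF assms(1-3), of a] by simp
qed

text \<open>Torsion-freeness: the mixed partial derivatives of \<open>r\<close> agree, and the
  remaining terms of \<open>rw_conn\<close> are symmetric in the two vectors.\<close>

lemma cov_symmetric: "z \<in> \<Omega> \<Longrightarrow> cov a (d r b) z = cov b (d r a) z"
  unfolding cov_def rw_conn_def using symmetric_second_derivative[OF \<Omega> _ r, of z a b]
  by (simp add: sfm_commute add.commute)

text \<open>The curvature tensor of the warped product, found by differentiating the closed formula
  twice: second derivatives of \<open>V\<close> and \<open>r\<close> cancel by symmetry, and the
  products of first derivatives cancel in pairs.\<close>

lemma curvature:
  fixes a b :: 'a
  assumes V: "rw_field V" and z: "z \<in> \<Omega>"
  defines "S \<equiv> space_form_metric c"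
  defines "t \<equiv> fst (r z)"
  defines "pa \<equiv> d r a z" and "pb \<equiv> d r b z"
  shows "cov b (cov a V) z - cov a (cov b V) z =
    (f t * deriv (deriv f) t *
       (fst pb * S (snd pa) (snd (V z)) - fst pa * S (snd pb) (snd (V z))),
     (deriv (deriv f) t / f t * fst (V z)) *\<^sub>R (fst pb *\<^sub>R snd pa - fst pa *\<^sub>R snd pb)
     + (c + (deriv f t)\<^sup>2) *\<^sub>R (S (snd pa) (snd (V z)) *\<^sub>R snd pb - S (snd pb) (snd (V z)) *\<^sub>R snd pa))"
proof -
  \<comment> \<open>\<open>F\<close> is the logarithmic derivative of f and \<open>dF\<close> is its
    derivative. Substituting f' = f F and f'' = f (dF + F^2) turns the final identity into a
    polynomial one.\<close>
  define F where "F = deriv f t / f t"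
  define dF where "dF = deriv (deriv f) t / f t - F * F"
  have ft: "f t \<noteq> 0" unfolding t_def using f_nz'[OF z] .
  note Vs = rw_field_smooth[OF V]
  define Va where "Va a = d V a z" for a
  define Vab where "Vab a b = d (d V a) b z" for a b
  define ra where "ra a = d r a z" for a
  define rab where "rab a b = d (d r a) b z" for a b
  have Vab: "Vab a b = Vab b a" and rab: "rab a b = rab b a" for a b
    unfolding Vab_def rab_def by (rule symmetric_second_derivative[OF \<Omega> z] Vs r)+
  have hV: "(V has_derivative Va) (at z)" unfolding Va_def using has_derivative_d[OF Vs z] .
  have hr: "(r has_derivative ra) (at z)" unfolding ra_def using has_derivative_d[OF r z] .
  have hVa: "(d V a has_derivative Vab a) (at z)" for a
    unfolding Vab_def using has_derivative_d[OF smooth_on_frechet_derivative[OF Vs] z] .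
  have hra: "(d r a has_derivative rab a) (at z)" for a
    unfolding rab_def using has_derivative_d[OF smooth_on_frechet_derivative[OF r] z] .
  have hf: "((\<lambda>z. f (fst (r z))) has_derivative (\<lambda>b. deriv f t * fst (ra b))) (at z)"
    unfolding t_def ra_def by (rule has_derivative_f[OF z])
  have "(deriv f has_real_derivative deriv (deriv f) t) (at t)"
    unfolding t_def by (rule smooth_on_imp_DERIV[OF smooth_on_deriv[OF I f] time_in[OF z]])
  then have hf': "((\<lambda>z. deriv f (fst (r z))) has_derivative (\<lambda>b. deriv (deriv f) t * fst (ra b))) (at z)"
    by (intro has_derivative_compose[of "\<lambda>z. fst (r z)" "\<lambda>b. fst (ra b)" z UNIV "deriv f"])
      (auto intro!: has_derivative_fst hr simp: has_field_derivative_def t_def)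
  have hF: "((\<lambda>z. deriv f (fst (r z)) / f (fst (r z))) has_derivative (\<lambda>b. dF * fst (ra b))) (at z)"
    by (rule derivative_eq_intros hf hf' refl)+
      (use ft in \<open>auto simp: t_def[symmetric] dF_def F_def fun_eq_iff field_simps\<close>)
  define p where "p = snd (r z)"
  \<comment> \<open>\<open>D1\<close> and \<open>D2\<close> are the time and space components of the
    derivative of \<open>cov a V\<close> in direction b, expanded by the product rule.\<close>
  define D1 where "D1 a b = fst (Vab a b) + (f t * deriv f t * (S (snd (ra a)) (snd (Va b)) + S (snd (rab a b)) (snd (V z)))
      + (f t * (deriv (deriv f) t * fst (ra b)) + deriv f t * fst (ra b) * deriv f t) * S (snd (ra a)) (snd (V z)))" for a b
  define D2 where "D2 a b = snd (Vab a b) + (F *\<^sub>R (fst (ra a) *\<^sub>R snd (Va b) + fst (rab a b) *\<^sub>R snd (V z)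
        + (fst (V z) *\<^sub>R snd (rab a b) + fst (Va b) *\<^sub>R snd (ra a)))
      + (dF * fst (ra b)) *\<^sub>R (fst (ra a) *\<^sub>R snd (V z) + fst (V z) *\<^sub>R snd (ra a)))
      + ((c * S (snd (ra a)) (snd (V z))) *\<^sub>R snd (ra b)
      + (c * (S (snd (ra a)) (snd (Va b)) + S (snd (rab a b)) (snd (V z)))) *\<^sub>R p)" for a b
  have D: "d (cov a V) b z = (D1 a b, D2 a b)" for a b
  proof (rule d_eqI)
    show "(cov a V has_derivative (\<lambda>b. (D1 a b, D2 a b))) (at z)"
      unfolding cov_def rw_conn_def D1_def D2_def
      by (rule has_derivative_Pair derivative_eq_intros hf hf' hF hV hr hVa hra sfm.FDERIV refl
          | simp add: fun_eq_iff S_def ra_def Va_def F_def t_def p_def)+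
  qed
  \<comment> \<open>Products of tangent vectors with the position vector occur only with the factor
    c, so this disjunction removes all of them.\<close>
  have c0: "c = 0 \<or> S (snd (ra a)) p = 0" for a
    using sfm_position_tangent[OF c dr_tangent[OF z, of a]] unfolding S_def p_def ra_def
    by (metis sfm_commute mult_eq_0_iff)
  have Sc: "S x y = S y x" for x y
    unfolding S_def by (rule sfm_commute)
  have cov: "cov a V z = (fst (Va a) + f t * deriv f t * S (snd (ra a)) (snd (V z)),
      snd (Va a) + F *\<^sub>R (fst (ra a) *\<^sub>R snd (V z) + fst (V z) *\<^sub>R snd (ra a))
      + (c * S (snd (ra a)) (snd (V z))) *\<^sub>R p)" for a
    by (simp add: cov_def rw_conn_def ra_def Va_def F_def t_def S_def p_def)
  have cov2: "cov b (cov a V) z = rw_conn f c (r z) (ra b) (cov a V z) (D1 a b, D2 a b)" for a b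
    by (simp add: cov_def[of b] D ra_def)
  have fF: "deriv f t = f t * F" using ft by (simp add: F_def)
  have ddf: "deriv (deriv f) t = f t * (dF + F * F)" using ft by (simp add: dF_def)
  have ddf_f: "deriv (deriv f) t / f t = dF + F * F" by (simp add: dF_def)
  have e: "pa = ra a" "pb = ra b" by (simp_all add: pa_def pb_def ra_def)
  have conn: "rw_conn f c (r z) u v v' = (fst v' + f t * deriv f t * S (snd u) (snd v),
      snd v' + F *\<^sub>R (fst u *\<^sub>R snd v + fst v *\<^sub>R snd u) + (c * S (snd u) (snd v)) *\<^sub>R p)" for u v v'
    by (simp add: rw_conn_def F_def t_def S_def p_def)
  have lin: "S (x + y) w = S x w + S y w" "S w (x + y) = S w x + S w y"
    "S (k *\<^sub>R x) w = k * S x w" "S w (k *\<^sub>R x) = k * S w x" for x y w k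
    by (simp_all add: S_def sfm_simps)
  show ?thesis
    unfolding ddf_f unfolding cov2 conn cov e ddf fF D1_def D2_def Vab[of b a] rab[of b a]
    using ft c0[of a] c0[of b]
    by (auto simp: lin Sc[of "snd (ra b)" "snd (ra a)"] Sc[of p] algebra_simps power2_eq_square)
qed

end

section \<open>Totally geodesic hypersurfaces over the space form\<close>

text \<open>These are the products of I with totally geodesic surfaces of the space form: sections
  by hyperplanes through the origin if c \<noteq> 0, and planes with any offset k if c = 0. The
  normal n is a constant ambient vector, so the tangency condition can be differentiated directly;
  as n is not isotropic, (0, n) witnesses that dF is nonzero.\<close>

lemma totally_geodesic_slice:
  fixes n :: "real \<times> (real^3)"
  assumes c: "c \<in> {-1, 0, 1}" and I: "open I" and f: "smooth_on I f" "\<And>t. t \<in> I \<Longrightarrow> f t \<noteq> 0"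
    and n: "space_form_metric c n n \<noteq> 0" "c = 0 \<Longrightarrow> fst n = 0" and k: "c \<noteq> 0 \<Longrightarrow> k = 0"
  shows "totally_geodesic_hypersurface f I c {q \<in> rw_space I c. space_form_metric c (snd q) n = k}"
    (is "totally_geodesic_hypersurface f I c ?S")
proof -
  define F where "F q = space_form_metric c (snd q) n - k" for q :: amb
  have lin: "bounded_linear (\<lambda>q :: amb. space_form_metric c (snd q) n)"
    using bounded_linear_compose[OF sfm.bounded_linear_left bounded_linear_snd] .
  have smooth: "smooth_on UNIV F"
    unfolding F_def
    by (intro smooth_on_diff smooth_on_bounded_linear[OF open_UNIV lin smooth_on_ident]
        smooth_on_const open_UNIV)
  have dF: "frechet_derivative F (at q) = (\<lambda>w. space_form_metric c (snd w) n)" for q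
  proof -
    have "(F has_derivative (\<lambda>w. space_form_metric c (snd w) n - 0)) (at q)"
      unfolding F_def
      by (intro has_derivative_diff bounded_linear_imp_has_derivative[OF lin] has_derivative_const)
    then show ?thesis by (metis (no_types, lifting) ext diff_zero frechet_derivative_at)
  qed
  have tangent: "(0, n) \<in> rw_tangent c q" if "q \<in> ?S" for q
  proof (cases "c = 0")
    case True
    then show ?thesis using n by (simp add: rw_tangent_def)
  next
    case False
    then have "c * c = 1" using c by auto
    moreover have "c * space_form_metric c (snd q) n = (c * c) * (fst (snd q) * fst n) + c * (snd (snd q) \<bullet> snd n)"
      by (simp add: space_form_metric_def algebra_simps)
    ultimately show ?thesis using that k[OF False] by (simp add: rw_tangent_def)
  qed
  have geodesic: "frechet_derivative F (at (\<gamma> \<tau>)) (rw_cov f c (\<gamma> \<tau>) (vector_derivative \<gamma> (at \<tau>)) (V \<tau>)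
      (vector_derivative V (at \<tau>))) = 0"
    if J: "open J" "smooth_on J \<gamma>" "smooth_on J V" "\<gamma> ` J \<subseteq> ?S"
      and V: "\<And>\<tau>. \<tau> \<in> J \<Longrightarrow> V \<tau> \<in> rw_tangent c (\<gamma> \<tau>) \<and> frechet_derivative F (at (\<gamma> \<tau>)) (V \<tau>) = 0"
      and \<tau>: "\<tau> \<in> J"
    for J and \<gamma> V :: "real \<Rightarrow> amb" and \<tau>
  proof -
    \<comment> \<open>The curve is treated as a patch with one-dimensional parameter space.\<close>
    interpret rw_patch f c I J \<gamma>
      using c I f J by unfold_locales auto
    have field: "rw_field V"
      using J V by (simp add: rw_field_def)
    have vec: "vector_derivative \<gamma> (at \<tau>) = d \<gamma> 1 \<tau>" "vector_derivative V (at \<tau>) = d V 1 \<tau>"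
      using frechet_derivative_eq_vector_derivative[OF smooth_on_imp_differentiable[OF J(2) \<tau>]]
        frechet_derivative_eq_vector_derivative[OF smooth_on_imp_differentiable[OF J(3) \<tau>]]
      by simp_all
    have const: "space_form_metric c (snd (d W 1 \<tau>)) n = 0"
      if "smooth_on J W" "\<And>\<tau>. \<tau> \<in> J \<Longrightarrow> space_form_metric c (snd (W \<tau>)) n = k'"
      for W :: "real \<Rightarrow> amb" and k'
    proof -
      have "d (\<lambda>z. space_form_metric c (snd (W z)) n) 1 \<tau> = space_form_metric c (snd (d W 1 \<tau>)) n"
        using bounded_linear.has_derivative[OF lin has_derivative_d[OF that(1) \<tau>]] by (rule d_eqI)
      moreover have "d (\<lambda>z. space_form_metric c (snd (W z)) n) 1 \<tau> = d (\<lambda>_. k') 1 \<tau>"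
        using frechet_derivative_cong_open[OF J(1) \<tau>, of "\<lambda>z. space_form_metric c (snd (W z)) n" "\<lambda>_. k'"]
          that(2) by simp
      ultimately show ?thesis by simp
    qed
    \<comment> \<open>The spatial part of \<open>rw_conn\<close> is a combination of exactly these
      vectors, the position carrying the factor c; hence its product with n vanishes.\<close>
    have "space_form_metric c (snd (d \<gamma> 1 \<tau>)) n = 0" "space_form_metric c (snd (d V 1 \<tau>)) n = 0"
      "space_form_metric c (snd (V \<tau>)) n = 0" "c * space_form_metric c (snd (\<gamma> \<tau>)) n = 0"
      using const[OF J(2), of k] const[OF J(3), of 0] J(4) V \<tau> k by (auto simp: dF)
    then show ?thesis
      unfolding vec rw_cov_eq_cov[OF field \<tau>] dF cov_def rw_conn_def by (auto simp: sfm_simps)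
  qed
  show ?thesis
    unfolding totally_geodesic_hypersurface_def
  proof (intro conjI ballI exI[of _ UNIV] exI[of _ F])
    fix q assume "q \<in> ?S \<inter> UNIV"
    then show "\<exists>w\<in>rw_tangent c q. frechet_derivative F (at q) w \<noteq> 0"
      using tangent[of q] n(1) by (intro bexI[of _ "(0, n)"]) (auto simp: dF)
  next
    show "\<forall>J \<gamma> V. open J \<and> is_interval J \<and> smooth_on J \<gamma> \<and> smooth_on J V \<and> \<gamma> ` J \<subseteq> ?S \<inter> UNIV \<and>
           (\<forall>\<tau>\<in>J. V \<tau> \<in> rw_tangent c (\<gamma> \<tau>) \<and> frechet_derivative F (at (\<gamma> \<tau>)) (V \<tau>) = 0)
           \<longrightarrow> (\<forall>\<tau>\<in>J. frechet_derivative F (at (\<gamma> \<tau>))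
                  (rw_cov f c (\<gamma> \<tau>) (vector_derivative \<gamma> (at \<tau>)) (V \<tau>)
                     (vector_derivative V (at \<tau>))) = 0)"
      using geodesic by auto
  qed (auto simp: smooth F_def)
qed

section \<open>Framed patches\<close>

text \<open>Formulated for forms of any signature, since e3 is time-like: only B v v \<noteq> 0 is
  available, and the coefficients are divided by these values.\<close>

lemma
  fixes B :: "'a::real_vector \<Rightarrow> 'a \<Rightarrow> real"
  assumes lin: "\<And>w. linear (\<lambda>v. B v w)" and S: "finite S"
    and orth: "\<And>v w. v \<in> S \<Longrightarrow> w \<in> S \<Longrightarrow> v \<noteq> w \<Longrightarrow> B v w = 0"
    and nz: "\<And>v. v \<in> S \<Longrightarrow> B v v \<noteq> 0"
  shows orthogonal_independent: "independent S"
    and orthogonal_expansion: "v \<in> span S \<Longrightarrow> v = (\<Sum>w\<in>S. (B v w / B w w) *\<^sub>R w)"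
proof -
  have coeff: "B (\<Sum>w\<in>S. u w *\<^sub>R w) v = u v * B v v" if "v \<in> S" for u v
  proof -
    interpret linear "\<lambda>x. B x v" by (rule lin)
    have "B (\<Sum>w\<in>S. u w *\<^sub>R w) v = (\<Sum>w\<in>S. u w * B w v)"
      by (simp add: sum scale)
    also have "\<dots> = (\<Sum>w\<in>S. if w = v then u v * B v v else 0)"
      using orth that by (intro sum.cong) auto
    finally show ?thesis using S that by simp
  qed
  have zero: "B 0 v = 0" for v
    using linear_0[OF lin] .
  show "independent S"
    using S nz coeff zero by (auto simp: dependent_finite) (metis mult_eq_0_iff)
  show "v = (\<Sum>w\<in>S. (B v w / B w w) *\<^sub>R w)" if "v \<in> span S"
  proof -
    obtain u where u: "v = (\<Sum>w\<in>S. u w *\<^sub>R w)"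
      using \<open>v \<in> span S\<close> S by (auto simp: span_finite)
    have "u w = B v w / B w w" if "w \<in> S" for w
      using coeff[OF that, of u] nz[OF that] by (simp add: u)
    then show ?thesis
      by (subst u) (auto intro: sum.cong)
  qed
qed

text \<open>The framed surface read in one chart, so that everything lives on an open subset of the
  plane. \<open>sinh_nz\<close> is the nonvanishing of T in terms of the frame.\<close>

locale framed_patch = rw_patch f c I \<Omega> r
  for f c I \<Omega> and r :: "real^2 \<Rightarrow> amb" +
  fixes e1 e2 e3 e4 :: "real^2 \<Rightarrow> amb" and \<theta> :: "real^2 \<Rightarrow> real"
  assumes immersion: "\<And>z. z \<in> \<Omega> \<Longrightarrow> inj (\<lambda>a. d r a z)"
    and smooth_frame: "smooth_on \<Omega> e1" "smooth_on \<Omega> e2" "smooth_on \<Omega> e3" "smooth_on \<Omega> e4"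
    and frame_tangent: "\<And>z. z \<in> \<Omega> \<Longrightarrow> e1 z \<in> range (\<lambda>a. d r a z)" "\<And>z. z \<in> \<Omega> \<Longrightarrow> e2 z \<in> range (\<lambda>a. d r a z)"
    and frame_normal: "\<And>z. z \<in> \<Omega> \<Longrightarrow> e3 z \<in> rw_tangent c (r z)" "\<And>z. z \<in> \<Omega> \<Longrightarrow> e4 z \<in> rw_tangent c (r z)"
      "\<And>z a. z \<in> \<Omega> \<Longrightarrow> g z (e3 z) (d r a z) = 0" "\<And>z a. z \<in> \<Omega> \<Longrightarrow> g z (e4 z) (d r a z) = 0"
    and orthonormal: "\<And>z. z \<in> \<Omega> \<Longrightarrow>
        g z (e1 z) (e1 z) = 1 \<and> g z (e2 z) (e2 z) = 1 \<and> g z (e3 z) (e3 z) = -1 \<and> g z (e4 z) (e4 z) = 1 \<and>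
        g z (e1 z) (e2 z) = 0 \<and> g z (e1 z) (e3 z) = 0 \<and> g z (e1 z) (e4 z) = 0 \<and>
        g z (e2 z) (e3 z) = 0 \<and> g z (e2 z) (e4 z) = 0 \<and> g z (e3 z) (e4 z) = 0"
    and partial_t_frame: "\<And>z. z \<in> \<Omega> \<Longrightarrow> partial_t = sinh (\<theta> z) *\<^sub>R e1 z + cosh (\<theta> z) *\<^sub>R e3 z"
    and sinh_nz: "\<And>z. z \<in> \<Omega> \<Longrightarrow> sinh (\<theta> z) \<noteq> 0"
begin

section \<open>Frame expansions and the second fundamental form\<close>

definition plane :: "real^2 \<Rightarrow> amb set" where
  "plane z = range (\<lambda>a. d r a z)"

lemma linear_g: "linear (\<lambda>v. g z v w)"
  by (rule linearI) (simp_all add: rw_metric_simps)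

lemma orthonormal':
  assumes "z \<in> \<Omega>"
  shows "g z (e1 z) (e1 z) = 1" "g z (e2 z) (e2 z) = 1" "g z (e3 z) (e3 z) = -1" "g z (e4 z) (e4 z) = 1"
    "g z (e1 z) (e2 z) = 0" "g z (e1 z) (e3 z) = 0" "g z (e1 z) (e4 z) = 0"
    "g z (e2 z) (e3 z) = 0" "g z (e2 z) (e4 z) = 0" "g z (e3 z) (e4 z) = 0"
    "g z (e2 z) (e1 z) = 0" "g z (e3 z) (e1 z) = 0" "g z (e4 z) (e1 z) = 0"
    "g z (e3 z) (e2 z) = 0" "g z (e4 z) (e2 z) = 0" "g z (e4 z) (e3 z) = 0"
  using orthonormal[OF assms] by (simp_all add: rw_metric_commute)

lemma frame_distinct:
  assumes "z \<in> \<Omega>"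
  shows "e1 z \<noteq> e2 z" "e1 z \<noteq> e3 z" "e1 z \<noteq> e4 z" "e2 z \<noteq> e3 z" "e2 z \<noteq> e4 z" "e3 z \<noteq> e4 z"
  using orthonormal'[OF assms] by force+

lemma frame_orthogonal:
  assumes "z \<in> \<Omega>" "v \<in> {e1 z, e2 z, e3 z, e4 z}" "w \<in> {e1 z, e2 z, e3 z, e4 z}" "v \<noteq> w"
  shows "g z v w = 0"
  using assms(2-4) orthonormal'[OF assms(1)] by (elim insertE emptyE) simp_all

lemma frame_nonisotropic:
  assumes "z \<in> \<Omega>" "v \<in> {e1 z, e2 z, e3 z, e4 z}"
  shows "g z v v \<noteq> 0"
  using assms(2) orthonormal'[OF assms(1)] by (elim insertE emptyE) simp_all

lemma plane_expansion:
  assumes z: "z \<in> \<Omega>" and v: "v \<in> plane z"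
  shows "v = g z v (e1 z) *\<^sub>R e1 z + g z v (e2 z) *\<^sub>R e2 z"
proof -
  let ?S = "{e1 z, e2 z}"
  have lin: "linear (\<lambda>a. d r a z)" by (rule linear_d[OF r z])
  have "dim (plane z) = 2"
    unfolding plane_def using dim_image_eq[OF lin, of UNIV] immersion[OF z] by simp
  moreover have S: "independent ?S"
    by (rule orthogonal_independent[of "g z", OF linear_g _ frame_orthogonal frame_nonisotropic])
      (use z in auto)
  moreover have "?S \<subseteq> plane z"
    using frame_tangent[OF z] by (simp add: plane_def)
  ultimately have "plane z \<subseteq> span ?S"
    using card_eq_dim[of ?S "plane z"] frame_distinct[OF z] by auto
  then have "v = (\<Sum>w\<in>?S. (g z v w / g z w w) *\<^sub>R w)"
    by (intro orthogonal_expansion[of "g z", OF linear_g _ frame_orthogonal frame_nonisotropic])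
      (use z v in auto)
  then show ?thesis
    using orthonormal'[OF z] frame_distinct[OF z] by simp
qed

lemma tangent_expansion:
  assumes z: "z \<in> \<Omega>" and v: "v \<in> rw_tangent c (r z)"
  shows "v = g z v (e1 z) *\<^sub>R e1 z + g z v (e2 z) *\<^sub>R e2 z - g z v (e3 z) *\<^sub>R e3 z + g z v (e4 z) *\<^sub>R e4 z"
proof -
  let ?S = "{e1 z, e2 z, e3 z, e4 z}"
  have S: "independent ?S"
    by (rule orthogonal_independent[of "g z", OF linear_g _ frame_orthogonal frame_nonisotropic])
      (use z in auto)
  moreover have "?S \<subseteq> rw_tangent c (r z)"
    using frame_tangent[OF z] frame_normal[OF z] dr_tangent[OF z] by auto
  ultimately have "rw_tangent c (r z) \<subseteq> span ?S"
    using card_eq_dim[of ?S "rw_tangent c (r z)"] frame_distinct[OF z] dim_rw_tangent[OF r_space[OF z]] by auto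
  then have eq: "v = (\<Sum>w\<in>?S. (g z v w / g z w w) *\<^sub>R w)"
    by (intro orthogonal_expansion[of "g z", OF linear_g _ frame_orthogonal frame_nonisotropic])
      (use z v in auto)
  have "(\<Sum>w\<in>?S. (g z v w / g z w w) *\<^sub>R w) =
      g z v (e1 z) *\<^sub>R e1 z + g z v (e2 z) *\<^sub>R e2 z - g z v (e3 z) *\<^sub>R e3 z + g z v (e4 z) *\<^sub>R e4 z"
    using orthonormal'[OF z] frame_distinct[OF z] by (simp add: algebra_simps)
  with eq show ?thesis by (rule trans)
qed

lemma subspace_plane: "z \<in> \<Omega> \<Longrightarrow> subspace (plane z)"
  unfolding plane_def using linear_subspace_image[OF linear_d[OF r] subspace_UNIV] .

lemma dr_plane: "d r a z \<in> plane z"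
  by (simp add: plane_def)

lemma e_plane: "z \<in> \<Omega> \<Longrightarrow> e1 z \<in> plane z" "z \<in> \<Omega> \<Longrightarrow> e2 z \<in> plane z"
  using frame_tangent by (auto simp: plane_def)

lemma plane_tangent: "z \<in> \<Omega> \<Longrightarrow> v \<in> plane z \<Longrightarrow> v \<in> rw_tangent c (r z)"
  using dr_tangent by (auto simp: plane_def)

lemma planeI:
  assumes z: "z \<in> \<Omega>" and v: "v \<in> rw_tangent c (r z)" "g z v (e3 z) = 0" "g z v (e4 z) = 0"
  shows "v \<in> plane z"
proof -
  have "v = g z v (e1 z) *\<^sub>R e1 z + g z v (e2 z) *\<^sub>R e2 z"
    using tangent_expansion[OF z v(1)] v by simp
  then show ?thesis
    using e_plane[OF z] subspace_plane[OF z] by (metis subspace_add subspace_scale)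
qed

lemma plane_normal: "z \<in> \<Omega> \<Longrightarrow> v \<in> plane z \<Longrightarrow> g z v (e3 z) = 0"
  "z \<in> \<Omega> \<Longrightarrow> v \<in> plane z \<Longrightarrow> g z v (e4 z) = 0"
  using frame_normal by (auto simp: plane_def rw_metric_commute)

lemma rw_field_frame: "rw_field e1" "rw_field e2" "rw_field e3" "rw_field e4"
  using smooth_frame frame_normal e_plane plane_tangent by (auto simp: rw_field_def)

lemma rw_field_plane: "smooth_on \<Omega> V \<Longrightarrow> (\<And>z. z \<in> \<Omega> \<Longrightarrow> V z \<in> plane z) \<Longrightarrow> rw_field V"
  using plane_tangent by (auto simp: rw_field_def)

text \<open>Pairing with d/dt returns minus the time component, and d/dt is a combination of e1 and
  e3. In particular e2 and e4 are purely spatial, on which the curvature argument and the flat case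
  both rest.\<close>

lemma frame_time:
  assumes "z \<in> \<Omega>"
  shows "fst (e1 z) = - sinh (\<theta> z)" "fst (e2 z) = 0" "fst (e3 z) = cosh (\<theta> z)" "fst (e4 z) = 0"
proof -
  have "fst v = - (sinh (\<theta> z) * g z v (e1 z) + cosh (\<theta> z) * g z v (e3 z))" for v
    using rw_metric_partial_t[of f c "r z" v] unfolding partial_t_frame[OF assms] rw_metric_simps by simp
  then show "fst (e1 z) = - sinh (\<theta> z)" "fst (e2 z) = 0" "fst (e3 z) = cosh (\<theta> z)" "fst (e4 z) = 0"
    using orthonormal'[OF assms] by simp_all
qed

text \<open>
  For \<open>n\<close> one of the normal fields, \<open>K n a Y z\<close> is \<open>- \<langle>h(dr a, Y), n\<rangle>\<close>.
\<close>

abbreviation K :: "(real^2 \<Rightarrow> amb) \<Rightarrow> real^2 \<Rightarrow> amb \<Rightarrow> real^2 \<Rightarrow> real" where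
  "K n a Y z \<equiv> g z Y (cov a n z)"

text \<open>The Weingarten relation, from differentiating <V, n> = 0. The right side involves only
  the value of V at z, so the normal component does not depend on the extension.\<close>

lemma cov_normal_component:
  assumes "n \<in> {e3, e4}" "z \<in> \<Omega>" "smooth_on \<Omega> V" "\<And>z. z \<in> \<Omega> \<Longrightarrow> V z \<in> plane z"
  shows "g z (cov a V z) (n z) = - K n a (V z) z"
proof (rule metric_compatible_orthogonal[OF _ _ assms(2)])
  show "rw_field V" "rw_field n"
    using assms rw_field_frame rw_field_plane by auto
  show "g w (V w) (n w) = 0" if "w \<in> \<Omega>" for w
    using assms(1) plane_normal[OF that assms(4)[OF that]] by auto
qed

text \<open>Symmetry of the second fundamental form, inherited from \<open>cov_symmetric\<close>
  through the Weingarten relation.\<close>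

lemma K_symmetric:
  assumes "n \<in> {e3, e4}" "z \<in> \<Omega>"
  shows "K n a (d r b z) z = K n b (d r a z) z"
  using cov_normal_component[OF assms, of "d r a" b] cov_normal_component[OF assms, of "d r b" a]
    cov_symmetric[OF assms(2), of a b] smooth_on_frechet_derivative[OF r] dr_plane by simp

text \<open>The conclusion concerns one point with h4 \<noteq> 0, but nullity is assumed on the
  whole patch because it has to be differentiated: it makes every \<open>cov b V\<close> tangent, so
  that \<open>cov\<close> can be applied to it again and its normal part read off from h.\<close>

lemma tangent_parallel_normal:
  assumes V: "smooth_on \<Omega> V" "\<And>z. z \<in> \<Omega> \<Longrightarrow> V z \<in> plane z" "\<And>z. z \<in> \<Omega> \<Longrightarrow> V z \<noteq> 0"
    and null: "\<And>n a z. n \<in> {e3, e4} \<Longrightarrow> z \<in> \<Omega> \<Longrightarrow> K n a (V z) z = 0"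
    and curv: "\<And>t. t \<in> I \<Longrightarrow> deriv (deriv f) t / f t - ((deriv f t)\<^sup>2 + c) / (f t)\<^sup>2 \<noteq> 0"
    and z: "z \<in> \<Omega>" and non_flat: "K e4 a0 (d r b0 z) z \<noteq> 0"
  shows "g z (V z) (e2 z) = 0"
proof -
  let ?S = "space_form_metric c"
  \<comment> \<open>The direction a is constant, so \<open>cov a V\<close> is the derivative of V
    along itself only at z, where all the following identities are evaluated.\<close>
  obtain a where a: "V z = d r a z"
    using V(2)[OF z] by (auto simp: plane_def)
  have field: "rw_field V"
    using V by (intro rw_field_plane)
  have cov_normal: "g w (cov b V w) (n w) = 0" if "n \<in> {e3, e4}" "w \<in> \<Omega>" for n b w
    using cov_normal_component[OF that V(1,2), of b] null[OF that] by simp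
  have cov_plane: "cov b V w \<in> plane w" if "w \<in> \<Omega>" for b w
    using cov_normal[OF _ that, of _ b] rw_field_tangent[OF rw_field_cov[OF field, of b] that]
    by (intro planeI[OF that]) auto
  define W where "W = cov a V z"
  define R where "R b = cov b (cov a V) z - cov a (cov b V) z" for b
  have R: "g z (R b) (n z) = - K n b W z" if n: "n \<in> {e3, e4}" for n b
  proof -
    have K: "g z (cov b (cov a' V) z) (n z) = - K n b (cov a' V z) z" for b a'
      using cov_normal_component[OF n z rw_field_smooth[OF rw_field_cov[OF field]] cov_plane] .
    \<comment> \<open>Since \<open>cov b V\<close> is tangent at z, it is dr b' for some b';
      symmetry then exchanges it with V = dr a, and nullity removes this half of the
      curvature.\<close>
    obtain b' where b': "cov b V z = d r b' z"
      using cov_plane[OF z] by (auto simp: plane_def)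
    have "K n a (cov b V z) z = 0"
      unfolding b' K_symmetric[OF n z] using null[OF n z] a by simp
    then show ?thesis
      using K[of b a] K[of a b] by (simp add: R_def W_def rw_metric_simps)
  qed
  \<comment> \<open>Orthogonality of n to the surface in the warped metric, solved for the
    space-form product.\<close>
  have sp: "(f (fst (r z)))\<^sup>2 * ?S (snd v) (snd (n z)) = fst v * fst (n z)"
    if "n \<in> {e3, e4}" "v \<in> plane z" for n v
    using plane_normal[OF z that(2)] that(1) by (auto simp: rw_metric_def)
  let ?t = "fst (r z)"
  \<comment> \<open>Minus f^2 times the expression assumed to be nonzero.\<close>
  define k where "k = c + (deriv f ?t)\<^sup>2 - f ?t * deriv (deriv f) ?t"
  have gR: "g z (R b) (n z) = k * fst (n z) *
      (?S (snd (V z)) (snd (V z)) * fst (d r b z) - ?S (snd (d r b z)) (snd (V z)) * fst (V z))"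
    if n: "n \<in> {e3, e4}" for n b
  proof -
    have ft: "f ?t \<noteq> 0" by (rule f_nz'[OF z])
    define s where "s = (f ?t)\<^sup>2"
    have s: "s \<noteq> 0" using ft by (simp add: s_def)
    have eq: "?S (snd v) (snd (n z)) = fst v * fst (n z) / s" if "v \<in> plane z" for v
      using sp[OF n that] s by (simp add: s_def[symmetric] field_simps)
    have V': "?S (snd (V z)) (snd (n z)) = fst (V z) * fst (n z) / s"
      "?S (snd (d r b z)) (snd (n z)) = fst (d r b z) * fst (n z) / s"
      using eq V(2)[OF z] dr_plane by auto
    show ?thesis
      unfolding R_def curvature[OF field z] rw_metric_def a[symmetric] k_def s_def[symmetric]
      by (simp add: sfm_simps V' s) (simp add: field_simps s)
  qed
  have k: "k \<noteq> 0"
    using curv[OF time_in[OF z]] f_nz'[OF z] by (auto simp: k_def field_simps power2_eq_square)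
  \<comment> \<open>The curvature component along e4 carries the factor \<open>fst (e4 z)\<close>,
    which is zero.\<close>
  have W4: "K e4 b W z = 0" for b
    using R[of e4 b] gR[of e4 b] frame_time[OF z] by simp
  have W_parallel: "K e3 b W z = 0" for b
  proof -
    define v1 v2 w1 w2 where "v1 = g z (V z) (e1 z)" "v2 = g z (V z) (e2 z)" "w1 = g z W (e1 z)" "w2 = g z W (e2 z)"
    have V12: "V z = v1 *\<^sub>R e1 z + v2 *\<^sub>R e2 z" and W12: "W = w1 *\<^sub>R e1 z + w2 *\<^sub>R e2 z"
      unfolding v1_v2_w1_w2_def using plane_expansion[OF z] V(2)[OF z] cov_plane[OF z] by (auto simp: W_def)
    have 1: "v1 * K e4 a0 (e1 z) z + v2 * K e4 a0 (e2 z) z = 0"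
      using null[of e4 z a0] z by (simp add: V12 rw_metric_simps)
    have 2: "w1 * K e4 a0 (e1 z) z + w2 * K e4 a0 (e2 z) z = 0"
      using W4[of a0] by (simp add: W12 rw_metric_simps)
    \<comment> \<open>V and W both lie in the kernel of the functional \<open>K e4 a0\<close> on the
      tangent plane. It is nonzero, so the kernel is a line and the determinant of the coefficients
      of V and W vanishes.\<close>
    have "K e4 a0 (e1 z) z \<noteq> 0 \<or> K e4 a0 (e2 z) z \<noteq> 0"
      using non_flat by (subst (asm) plane_expansion[OF z dr_plane]) (auto simp: rw_metric_simps)
    then have det: "v1 * w2 = v2 * w1"
      using 1 2 by algebra
    have 3: "v1 * K e3 b (e1 z) z + v2 * K e3 b (e2 z) z = 0"
      using null[of e3 z b] z by (simp add: V12 rw_metric_simps)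
    have "v1 \<noteq> 0 \<or> v2 \<noteq> 0"
      using V(3)[OF z] V12 by auto
    then show ?thesis
      unfolding W12 rw_metric_simps using 3 det by algebra
  qed
  \<comment> \<open>With the e3-component of the curvature equal to zero, the factors k and cosh
    \<theta> can be cancelled.\<close>
  have key: "?S (snd (V z)) (snd (V z)) * fst y = ?S (snd y) (snd (V z)) * fst (V z)" if y: "y \<in> plane z" for y
  proof -
    obtain b where b: "y = d r b z" using y unfolding plane_def by blast
    show ?thesis
      using R[of e3 b] gR[of e3 b] W_parallel[of b] k frame_time[OF z] unfolding b by simp
  qed
  show ?thesis
  proof (rule ccontr)
    assume ne: "g z (V z) (e2 z) \<noteq> 0"
    \<comment> \<open>At y = e2 the left side of \<open>key\<close> vanishes because e2 is
      spatial.\<close>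
    have "?S (snd (e2 z)) (snd (V z)) * fst (V z) = 0"
      using key[OF e_plane(2)[OF z]] frame_time[OF z] by simp
    moreover have "?S (snd (e2 z)) (snd (V z)) \<noteq> 0"
      using ne frame_time[OF z] by (auto simp: rw_metric_def sfm_commute)
    ultimately have V0: "fst (V z) = 0" by simp
    \<comment> \<open>At y = e1 the right side is now zero, while the time component of e1 is - sinh
      \<theta> \<noteq> 0.\<close>
    then have "?S (snd (V z)) (snd (V z)) = 0"
      using key[OF e_plane(1)[OF z]] frame_time[OF z] sinh_nz[OF z] by simp
    then have "g z (V z) (V z) = 0"
      using V0 by (simp add: rw_metric_def)
    moreover have "g z (V z) (V z) = (g z (V z) (e1 z))\<^sup>2 + (g z (V z) (e2 z))\<^sup>2"
      by (subst plane_expansion[OF z V(2)[OF z]])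
        (simp add: rw_metric_simps rw_metric_commute power2_eq_square)
    ultimately show False
      using ne by (simp add: sum_power2_eq_zero_iff)
  qed
qed

text \<open>When e4 is parallel, the rescaled spatial part f e4 is constant in the ambient linear
  space; the factor f absorbs the warping term of the connection. This constant is the normal of the
  required hypersurface.\<close>

lemma flat_imp_totally_geodesic:
  assumes conn: "connected \<Omega>" "\<Omega> \<noteq> {}"
    and flat: "\<And>z a b. z \<in> \<Omega> \<Longrightarrow> K e4 a (d r b z) z = 0"
  shows "\<exists>S. totally_geodesic_hypersurface f I c S \<and> r ` \<Omega> \<subseteq> S"
proof -
  let ?S = "space_form_metric c"
  define \<nu> where "\<nu> z = f (fst (r z)) *\<^sub>R snd (e4 z)" for z
  have S_dr: "?S (snd (d r a z)) (snd (e4 z)) = 0" if z: "z \<in> \<Omega>" for a z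
    using plane_normal(2)[OF z dr_plane, of a] frame_time[OF z] f_nz'[OF z] by (simp add: rw_metric_def)
  have cov0: "cov a e4 z = 0" if z: "z \<in> \<Omega>" for a z
  proof -
    have field: "rw_field (cov a e4)" by (rule rw_field_cov[OF rw_field_frame(4)])
    have plane: "g z v (cov a e4 z) = 0" if "v \<in> plane z" for v
      using that flat[OF z] by (auto simp: plane_def)
    have e4: "g z (cov a e4 z) (e4 z) = 0"
      using metric_compatible_orthogonal[OF rw_field_frame(4,4) z, of 1 a] orthonormal'
      by (simp add: rw_metric_commute)
    \<comment> \<open>Flatness and unit length do not control the e3-component. It is recovered from
      d/dt, since e4 stays spatial along the patch.\<close>
    have "fst (d e4 a z) = 0"
    proof -
      have "d (\<lambda>z. fst (e4 z)) a z = fst (d e4 a z)"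
        using has_derivative_fst[OF has_derivative_d[OF smooth_frame(4) z]] by (rule d_eqI)
      moreover have "d (\<lambda>z. fst (e4 z)) a z = d (\<lambda>_. 0) a z"
        using frechet_derivative_cong_open[OF \<Omega> z, of "\<lambda>z. fst (e4 z)" "\<lambda>_. 0"] frame_time by simp
      ultimately show ?thesis by simp
    qed
    then have "fst (cov a e4 z) = 0"
      using S_dr[OF z] by (simp add: cov_def rw_conn_def)
    then have "g z (cov a e4 z) partial_t = 0"
      by (simp add: rw_metric_partial_t)
    then have e3: "g z (cov a e4 z) (e3 z) = 0"
      using plane[OF e_plane(1)[OF z]] unfolding partial_t_frame[OF z]
      by (simp add: rw_metric_simps rw_metric_commute[of f c "r z" "cov a e4 z" "e1 z"])
    show ?thesis
      using tangent_expansion[OF z rw_field_tangent[OF field z]] e3 e4 plane[OF e_plane(1)[OF z]] plane[OF e_plane(2)[OF z]]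
      by (simp add: rw_metric_commute[of f c "r z" "cov a e4 z" "e1 z"]
          rw_metric_commute[of f c "r z" "cov a e4 z" "e2 z"])
  qed
  have d\<nu>: "(\<nu> has_derivative (\<lambda>a. 0)) (at z)" if z: "z \<in> \<Omega>" for z
  proof -
    \<comment> \<open>The product rule for f e4 agrees with f times the spatial part of
      \<open>cov a e4\<close>: the other terms contain the time component of e4 or its product with
      dr, and both are zero.\<close>
    have "f (fst (r z)) *\<^sub>R snd (d e4 a z) + (deriv f (fst (r z)) * fst (d r a z)) *\<^sub>R snd (e4 z)
        = f (fst (r z)) *\<^sub>R snd (cov a e4 z)" for a
      using S_dr[OF z] frame_time[OF z] f_nz'[OF z] by (simp add: cov_def rw_conn_def scaleR_add_right)
    then have eq: "f (fst (r z)) *\<^sub>R snd (d e4 a z) + (deriv f (fst (r z)) * fst (d r a z)) *\<^sub>R snd (e4 z) = 0" for a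
      using cov0[OF z] by simp
    have "(\<nu> has_derivative (\<lambda>a. f (fst (r z)) *\<^sub>R snd (d e4 a z) + (deriv f (fst (r z)) * fst (d r a z)) *\<^sub>R snd (e4 z))) (at z)"
      unfolding \<nu>_def
      by (intro has_derivative_scaleR has_derivative_f[OF z] has_derivative_snd has_derivative_d[OF smooth_frame(4) z])
    then show ?thesis by (simp only: eq)
  qed
  obtain n where n: "\<And>z. z \<in> \<Omega> \<Longrightarrow> \<nu> z = n"
    using has_derivative_zero_unique_connected[OF \<Omega> conn(1), of \<nu>] d\<nu> by metis
  have "((\<lambda>z. ?S (snd (r z)) n) has_derivative (\<lambda>a. 0)) (at z)" if z: "z \<in> \<Omega>" for z
  proof -
    have "((\<lambda>z. ?S (snd (r z)) n) has_derivative (\<lambda>a. ?S (snd (d r a z)) n)) (at z)"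
      by (rule bounded_linear.has_derivative[OF sfm.bounded_linear_left has_derivative_snd[OF has_derivative_d[OF r z]]])
    moreover have "?S (snd (d r a z)) n = 0" for a
      using S_dr[OF z] n[OF z] by (auto simp: \<nu>_def sfm_simps)
    ultimately show ?thesis by simp
  qed
  then obtain k where k: "\<And>z. z \<in> \<Omega> \<Longrightarrow> ?S (snd (r z)) n = k"
    using has_derivative_zero_unique_connected[OF \<Omega> conn(1), of "\<lambda>z. ?S (snd (r z)) n"] by metis
  obtain z where z: "z \<in> \<Omega>" using conn by blast
  have nz: "n = f (fst (r z)) *\<^sub>R snd (e4 z)" using n[OF z] by (simp add: \<nu>_def)
  have "?S n n = 1"
    using orthonormal'(4)[OF z] frame_time(4)[OF z]
    by (simp add: nz sfm_simps rw_metric_def power2_eq_square)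
  moreover have "fst n = 0" if "c = 0"
    using frame_normal(2)[OF z] r_space[OF z] that
    by (auto simp: nz rw_tangent_def rw_space_def space_form_def)
  \<comment> \<open>For c \<noteq> 0 the position vector is orthogonal to the tangent vector e4, so
    the hyperplane passes through the origin.\<close>
  moreover have "k = 0" if "c \<noteq> 0"
    using sfm_position_tangent[OF c frame_normal(2)[OF z]] that k[OF z] by (auto simp: nz sfm_simps)
  ultimately have "totally_geodesic_hypersurface f I c {q \<in> rw_space I c. ?S (snd q) n = k}"
    by (intro totally_geodesic_slice c I f f_nz) auto
  moreover have "r ` \<Omega> \<subseteq> {q \<in> rw_space I c. ?S (snd q) n = k}"
  proof (rule image_subsetI)
    show "r z \<in> {q \<in> rw_space I c. ?S (snd q) n = k}" if "z \<in> \<Omega>" for z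
      using k[OF that] r_space[OF that] by simp
  qed
  ultimately show ?thesis by blast
qed

text \<open>Provides the passage to a coordinate ball, whose connectedness makes functions with zero
  derivative constant.\<close>

lemma framed_patch_subset:
  assumes "open \<Omega>'" "\<Omega>' \<subseteq> \<Omega>"
  shows "framed_patch f c I \<Omega>' r e1 e2 e3 e4 \<theta>"
proof -
  have sub: "z \<in> \<Omega>' \<Longrightarrow> z \<in> \<Omega>" for z using assms by blast
  show ?thesis
    by unfold_locales (rule c I f assms sub immersion frame_tangent frame_normal orthonormal
        partial_t_frame sinh_nz f_nz r_space smooth_on_subset[OF r] smooth_frame[THEN smooth_on_subset]
        | assumption | erule sub)+
qed

lemma smooth_K:
  assumes "n \<in> {e3, e4}" "smooth_on \<Omega> V"
  shows "smooth_on \<Omega> (\<lambda>z. K n a (V z) z)"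
  using assms rw_field_smooth[OF rw_field_cov[OF rw_field_frame(3)]]
    rw_field_smooth[OF rw_field_cov[OF rw_field_frame(4)]]
  by (auto intro!: smooth_metric)

end

section \<open>Space-like surfaces\<close>

locale rw_surface =
  fixes c :: real and I :: "real set" and f :: "real \<Rightarrow> real"
    and A :: "'m::{t2_space, second_countable_topology} chart set" and x :: "'m \<Rightarrow> amb"
  assumes c: "c \<in> {-1, 0, 1}"
    and I: "open I" and f: "smooth_on I f" and f_nz: "\<And>t. t \<in> I \<Longrightarrow> f t \<noteq> 0"
    and surface: "immersed_surface I c A x" and space_like: "spacelike f c A x"
begin

section \<open>Charts, tangent planes and normal parts\<close>

lemma chart:
  assumes "(D, \<psi>) \<in> A"
  shows "open D" "open (\<psi> ` D)" "homeomorphism D (\<psi> ` D) \<psi> (inv_into D \<psi>)" "inj_on \<psi> D"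
proof -
  show "open D" "open (\<psi> ` D)" and h: "homeomorphism D (\<psi> ` D) \<psi> (inv_into D \<psi>)"
    using surface assms unfolding immersed_surface_def smooth_surface_atlas_def by auto
  show "inj_on \<psi> D"
    using homeomorphism_apply1[OF h] by (metis inj_onI)
qed

lemma obtain_chart:
  obtains D \<psi> where "(D, \<psi>) \<in> A" "m \<in> D"
proof -
  have "m \<in> (\<Union>\<kappa>\<in>A. fst \<kappa>)"
    using surface unfolding immersed_surface_def smooth_surface_atlas_def by auto
  then show ?thesis
    using that by auto
qed

lemma open_chart_image:
  assumes "(D, \<psi>) \<in> A" "open W"
  shows "open (\<psi> ` (D \<inter> W))"
proof -
  have "openin (top_of_set (\<psi> ` D)) (\<psi> ` (D \<inter> W))"
    using homeomorphism_imp_open_map[OF chart(3)[OF assms(1)]] assms(2) by (simp add: openin_open_Int)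
  then show ?thesis
    using chart(2)[OF assms(1)] openin_open_trans by blast
qed

lemma in_chart_apply: "(D, \<psi>) \<in> A \<Longrightarrow> m \<in> D \<Longrightarrow> in_chart (D, \<psi>) F (\<psi> m) = F m"
  using chart(4) by (simp add: in_chart_def)

lemma smooth_in_chart:
  "(D, \<psi>) \<in> A \<Longrightarrow> smooth_map A W F \<Longrightarrow> smooth_on (\<psi> ` (D \<inter> W)) (in_chart (D, \<psi>) F)"
  unfolding smooth_map_def by auto

lemma smooth_x: "smooth_map A UNIV x"
  using surface by (simp add: immersed_surface_def)

lemma x_space: "x m \<in> rw_space I c"
  using surface by (auto simp: immersed_surface_def)

lemma x_immersion:
  "(D, \<psi>) \<in> A \<Longrightarrow> m \<in> D \<Longrightarrow> inj (frechet_derivative (in_chart (D, \<psi>) x) (at (\<psi> m)))"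
  using surface unfolding immersed_surface_def by auto

lemma differentiable_in_chart:
  assumes "(D, \<psi>) \<in> A" "m \<in> D" "m \<in> W" "smooth_map A W F"
  shows "in_chart (D, \<psi>) F differentiable (at (\<psi> m))"
  using smooth_on_imp_differentiable[OF smooth_in_chart[OF assms(1,4)]] assms(2,3) by auto

text \<open>The chain rule through the transition map. It makes \<open>tangent_plane\<close> and
  \<open>dir_deriv\<close>, which quantify over all charts, computable in any single one.\<close>

lemma chart_change:
  assumes \<kappa>: "(D, \<psi>) \<in> A" "(D', \<psi>') \<in> A" and m: "m \<in> D" "m \<in> D'"
    and F: "in_chart (D', \<psi>') F differentiable (at (\<psi>' m))"
  shows "frechet_derivative (in_chart (D, \<psi>) F) (at (\<psi> m)) a =
    frechet_derivative (in_chart (D', \<psi>') F) (at (\<psi>' m))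
      (frechet_derivative (in_chart (D, \<psi>) \<psi>') (at (\<psi> m)) a)"
proof -
  let ?\<tau> = "in_chart (D, \<psi>) \<psi>'"
  have op: "open (\<psi> ` (D \<inter> D'))"
    using open_chart_image[OF \<kappa>(1) chart(1)[OF \<kappa>(2)]] .
  have mem: "\<psi> m \<in> \<psi> ` (D \<inter> D')" using m by blast
  have "smooth_on (\<psi> ` (D \<inter> D')) ?\<tau>"
    using surface \<kappa> unfolding immersed_surface_def smooth_surface_atlas_def by blast
  then have \<tau>: "(?\<tau> has_derivative frechet_derivative ?\<tau> (at (\<psi> m))) (at (\<psi> m))"
    using mem by (rule smooth_on_imp_has_derivative)
  have F': "(in_chart (D', \<psi>') F has_derivative frechet_derivative (in_chart (D', \<psi>') F) (at (?\<tau> (\<psi> m)))) (at (?\<tau> (\<psi> m)))"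
    using F by (simp add: in_chart_apply[OF \<kappa>(1) m(1)] frechet_derivative_works[symmetric])
  have "((\<lambda>z. in_chart (D', \<psi>') F (?\<tau> z)) has_derivative
      (\<lambda>a. frechet_derivative (in_chart (D', \<psi>') F) (at (?\<tau> (\<psi> m))) (frechet_derivative ?\<tau> (at (\<psi> m)) a))) (at (\<psi> m))"
    by (rule has_derivative_compose[OF \<tau> F'])
  then have "(in_chart (D, \<psi>) F has_derivative
      (\<lambda>a. frechet_derivative (in_chart (D', \<psi>') F) (at (?\<tau> (\<psi> m))) (frechet_derivative ?\<tau> (at (\<psi> m)) a))) (at (\<psi> m))"
  proof (rule has_derivative_transform_within_open[OF _ op mem])
    fix z assume "z \<in> \<psi> ` (D \<inter> D')"
    then show "in_chart (D', \<psi>') F (?\<tau> z) = in_chart (D, \<psi>) F z"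
      using \<kappa> by (auto simp: in_chart_apply)
  qed
  then show ?thesis
    by (subst frechet_derivative_at[symmetric]) (auto simp: in_chart_apply[OF \<kappa>(1) m(1)])
qed

lemma tangent_plane_eq:
  assumes "(D, \<psi>) \<in> A" "m \<in> D"
  shows "tangent_plane A x m = range (\<lambda>a. frechet_derivative (in_chart (D, \<psi>) x) (at (\<psi> m)) a)"
proof
  show "range (\<lambda>a. frechet_derivative (in_chart (D, \<psi>) x) (at (\<psi> m)) a) \<subseteq> tangent_plane A x m"
    unfolding tangent_plane_def using assms by blast
  show "tangent_plane A x m \<subseteq> range (\<lambda>a. frechet_derivative (in_chart (D, \<psi>) x) (at (\<psi> m)) a)"
  proof
    fix X assume "X \<in> tangent_plane A x m"
    then obtain D' \<psi>' a where "(D', \<psi>') \<in> A" "m \<in> D'"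
      "X = frechet_derivative (in_chart (D', \<psi>') x) (at (\<psi>' m)) a"
      unfolding tangent_plane_def by blast
    then show "X \<in> range (\<lambda>a. frechet_derivative (in_chart (D, \<psi>) x) (at (\<psi> m)) a)"
      using chart_change[OF _ assms(1) _ assms(2), of D' \<psi>' x a]
        differentiable_in_chart[OF assms _ smooth_x] by simp
  qed
qed

lemma subspace_tangent_plane: "subspace (tangent_plane A x m)"
proof -
  obtain D \<psi> where \<kappa>: "(D, \<psi>) \<in> A" "m \<in> D" by (rule obtain_chart)
  show ?thesis
    unfolding tangent_plane_eq[OF \<kappa>]
    using linear_subspace_image[OF linear_frechet_derivative[OF differentiable_in_chart[OF \<kappa> _ smooth_x]] subspace_UNIV]
    by simp
qed

text \<open>If two charts represent the same tangent vector, injectivity of dx forces their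
  coordinate vectors to correspond under the transition map, so the derivatives of F agree.\<close>

lemma dir_deriv_eq:
  assumes \<kappa>: "(D, \<psi>) \<in> A" "m \<in> D" and F: "m \<in> W" "smooth_map A W F"
  shows "dir_deriv A x F m (frechet_derivative (in_chart (D, \<psi>) x) (at (\<psi> m)) a) =
    frechet_derivative (in_chart (D, \<psi>) F) (at (\<psi> m)) a"
  unfolding dir_deriv_def
proof (rule the_equality)
  show "\<exists>(U, \<phi>)\<in>A. m \<in> U \<and> (\<exists>a'. frechet_derivative (in_chart (D, \<psi>) x) (at (\<psi> m)) a =
          frechet_derivative (in_chart (U, \<phi>) x) (at (\<phi> m)) a' \<and>
        frechet_derivative (in_chart (D, \<psi>) F) (at (\<psi> m)) a =
          frechet_derivative (in_chart (U, \<phi>) F) (at (\<phi> m)) a')"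
    using \<kappa> by blast
  fix d
  assume "\<exists>(U, \<phi>)\<in>A. m \<in> U \<and> (\<exists>a'. frechet_derivative (in_chart (D, \<psi>) x) (at (\<psi> m)) a =
          frechet_derivative (in_chart (U, \<phi>) x) (at (\<phi> m)) a' \<and>
        d = frechet_derivative (in_chart (U, \<phi>) F) (at (\<phi> m)) a')"
  then obtain U \<phi> a' where U: "(U, \<phi>) \<in> A" "m \<in> U"
    and x: "frechet_derivative (in_chart (D, \<psi>) x) (at (\<psi> m)) a =
      frechet_derivative (in_chart (U, \<phi>) x) (at (\<phi> m)) a'"
    and d: "d = frechet_derivative (in_chart (U, \<phi>) F) (at (\<phi> m)) a'"
    by blast
  let ?b = "frechet_derivative (in_chart (U, \<phi>) \<psi>) (at (\<phi> m)) a'"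
  have "frechet_derivative (in_chart (U, \<phi>) x) (at (\<phi> m)) a' =
      frechet_derivative (in_chart (D, \<psi>) x) (at (\<psi> m)) ?b"
    by (rule chart_change[OF U(1) \<kappa>(1) U(2) \<kappa>(2) differentiable_in_chart[OF \<kappa> _ smooth_x]]) simp
  then have "a = ?b"
    using x x_immersion[OF \<kappa>] by (simp add: inj_eq)
  moreover have "d = frechet_derivative (in_chart (D, \<psi>) F) (at (\<psi> m)) ?b"
    unfolding d by (rule chart_change[OF U(1) \<kappa>(1) U(2) \<kappa>(2) differentiable_in_chart[OF \<kappa> F]])
  ultimately show "d = frechet_derivative (in_chart (D, \<psi>) F) (at (\<psi> m)) a" by simp
qed

text \<open>Two candidates differ by a vector both tangent and normal, hence of zero length; on a
  space-like tangent plane such a vector is zero.\<close>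

lemma normal_part_eq:
  assumes n: "n \<in> normal_plane f c A x m" and v: "v - n \<in> tangent_plane A x m"
  shows "normal_part f c A x m v = n"
  unfolding normal_part_def
proof (rule the_equality)
  show "n \<in> normal_plane f c A x m \<and> v - n \<in> tangent_plane A x m" using assms by blast
  fix n' assume n': "n' \<in> normal_plane f c A x m \<and> v - n' \<in> tangent_plane A x m"
  have "(v - n) - (v - n') \<in> tangent_plane A x m"
    using subspace_diff[OF subspace_tangent_plane v] n' by blast
  then have t: "n' - n \<in> tangent_plane A x m" by simp
  then have "rw_metric f c (x m) (n' - n) (n' - n) = 0"
    using n n' unfolding rw_metric_simps(3) by (simp add: normal_plane_def)
  then show "n' = n"
    using t space_like unfolding spacelike_def by force
qed

lemma subspace_normal_plane: "subspace (normal_plane f c A x m)"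
  using subspace_rw_tangent[of c "x m"]
  by (auto simp: subspace_def normal_plane_def rw_metric_simps)

end

locale framed_surface = rw_surface c I f A x
  for c I f and A :: "'m::{t2_space, second_countable_topology} chart set" and x +
  fixes U :: "'m set" and e1 e2 e3 e4 :: "'m \<Rightarrow> amb" and \<theta> :: "'m \<Rightarrow> real"
  assumes frame: "adapted_frame f c A x U e1 e2 e3 e4 \<theta>"
    and T_nonzero: "\<And>m. tangential_part f c A x m partial_t \<noteq> 0"
begin

section \<open>The frame and the second fundamental form in charts\<close>

lemma open_U: "open U"
  using frame by (simp add: adapted_frame_def)

lemma frame_smooth: "smooth_map A U e1" "smooth_map A U e2" "smooth_map A U e3" "smooth_map A U e4"
  using frame by (simp_all add: adapted_frame_def tangent_field_def normal_field_def)

lemma frame_planes: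
  assumes "q \<in> U"
  shows "e1 q \<in> tangent_plane A x q" "e2 q \<in> tangent_plane A x q"
    "e3 q \<in> normal_plane f c A x q" "e4 q \<in> normal_plane f c A x q"
  using frame assms by (simp_all add: adapted_frame_def tangent_field_def normal_field_def)

lemma frame_partial_t:
  "q \<in> U \<Longrightarrow> partial_t = sinh (\<theta> q) *\<^sub>R e1 q + cosh (\<theta> q) *\<^sub>R e3 q"
  using frame by (simp add: adapted_frame_def Let_def)

text \<open>The frame equation is already the splitting of d/dt into tangential and normal parts, so
  T = sinh \<theta> e1.\<close>

lemma sinh_nonzero:
  assumes q: "q \<in> U"
  shows "sinh (\<theta> q) \<noteq> 0"
proof -
  have "normal_part f c A x q partial_t = cosh (\<theta> q) *\<^sub>R e3 q"
  proof (rule normal_part_eq)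
    show "cosh (\<theta> q) *\<^sub>R e3 q \<in> normal_plane f c A x q"
      using frame_planes[OF q] subspace_normal_plane subspace_scale by blast
    have "partial_t - cosh (\<theta> q) *\<^sub>R e3 q = sinh (\<theta> q) *\<^sub>R e1 q"
      by (subst frame_partial_t[OF q]) simp
    then show "partial_t - cosh (\<theta> q) *\<^sub>R e3 q \<in> tangent_plane A x q"
      using frame_planes[OF q] subspace_tangent_plane subspace_scale by metis
  qed
  then have "tangential_part f c A x q partial_t = sinh (\<theta> q) *\<^sub>R e1 q"
    unfolding tangential_part_def using frame_partial_t[OF q] by (metis add_diff_cancel_right')
  then show ?thesis
    using T_nonzero[of q] by auto
qed

text \<open>Carries the surface over to the planar calculus. The extra open set W leaves room to
  shrink to the domain of a further field.\<close>

lemma framed_patch_chart: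
  assumes \<kappa>: "(D, \<psi>) \<in> A" and W: "open W" "W \<subseteq> U"
  shows "framed_patch f c I (\<psi> ` (D \<inter> W)) (in_chart (D, \<psi>) x) (in_chart (D, \<psi>) e1)
    (in_chart (D, \<psi>) e2) (in_chart (D, \<psi>) e3) (in_chart (D, \<psi>) e4) (in_chart (D, \<psi>) \<theta>)"
proof -
  have sub: "\<psi> ` (D \<inter> W) \<subseteq> \<psi> ` (D \<inter> U)" "\<psi> ` (D \<inter> W) \<subseteq> \<psi> ` (D \<inter> UNIV)" using W by auto
  have smooth: "smooth_on (\<psi> ` (D \<inter> W)) (in_chart (D, \<psi>) F)" if "smooth_map A U F" for F :: "'m \<Rightarrow> amb"
    using smooth_on_subset[OF smooth_in_chart[OF \<kappa> that] sub(1)] .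
  have pt: "\<exists>m. m \<in> D \<and> m \<in> U \<and> z = \<psi> m \<and> (\<forall>F :: 'm \<Rightarrow> amb. in_chart (D, \<psi>) F z = F m) \<and> in_chart (D, \<psi>) \<theta> z = \<theta> m"
    if "z \<in> \<psi> ` (D \<inter> W)" for z
    using that W by (auto simp: in_chart_apply[OF \<kappa>])
  show ?thesis
  proof unfold_locales
    show "open (\<psi> ` (D \<inter> W))" by (rule open_chart_image[OF \<kappa> W(1)])
    show "smooth_on (\<psi> ` (D \<inter> W)) (in_chart (D, \<psi>) x)"
      using smooth_on_subset[OF smooth_in_chart[OF \<kappa> smooth_x] sub(2)] .
    fix z assume "z \<in> \<psi> ` (D \<inter> W)"
    then obtain m where m: "m \<in> D" "m \<in> U" "z = \<psi> m" and
      F: "\<And>F :: 'm \<Rightarrow> amb. in_chart (D, \<psi>) F z = F m" and \<theta>: "in_chart (D, \<psi>) \<theta> z = \<theta> m"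
      using pt by blast
    show "in_chart (D, \<psi>) x z \<in> rw_space I c" by (simp add: F x_space)
    show "inj (frechet_derivative (in_chart (D, \<psi>) x) (at z))"
      unfolding m(3) by (rule x_immersion[OF \<kappa> m(1)])
    show "in_chart (D, \<psi>) e1 z \<in> range (frechet_derivative (in_chart (D, \<psi>) x) (at z))"
      "in_chart (D, \<psi>) e2 z \<in> range (frechet_derivative (in_chart (D, \<psi>) x) (at z))"
      using frame_planes(1,2)[OF m(2)] unfolding F unfolding tangent_plane_eq[OF \<kappa> m(1)] m(3) .
    show "in_chart (D, \<psi>) e3 z \<in> rw_tangent c (in_chart (D, \<psi>) x z)"
      "in_chart (D, \<psi>) e4 z \<in> rw_tangent c (in_chart (D, \<psi>) x z)"
      "\<And>a. rw_metric f c (in_chart (D, \<psi>) x z) (in_chart (D, \<psi>) e3 z) (frechet_derivative (in_chart (D, \<psi>) x) (at z) a) = 0"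
      "\<And>a. rw_metric f c (in_chart (D, \<psi>) x z) (in_chart (D, \<psi>) e4 z) (frechet_derivative (in_chart (D, \<psi>) x) (at z) a) = 0"
      using frame_planes(3,4)[OF m(2)] unfolding F
      unfolding normal_plane_def tangent_plane_eq[OF \<kappa> m(1)] m(3) by auto
    show "partial_t = sinh (in_chart (D, \<psi>) \<theta> z) *\<^sub>R in_chart (D, \<psi>) e1 z + cosh (in_chart (D, \<psi>) \<theta> z) *\<^sub>R in_chart (D, \<psi>) e3 z"
      unfolding F \<theta> by (rule frame_partial_t[OF m(2)])
    show "sinh (in_chart (D, \<psi>) \<theta> z) \<noteq> 0"
      unfolding \<theta> by (rule sinh_nonzero[OF m(2)])
    let ?g = "rw_metric f c (in_chart (D, \<psi>) x z)"
    let ?e1 = "in_chart (D, \<psi>) e1 z" and ?e2 = "in_chart (D, \<psi>) e2 z"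
      and ?e3 = "in_chart (D, \<psi>) e3 z" and ?e4 = "in_chart (D, \<psi>) e4 z"
    show "?g ?e1 ?e1 = 1 \<and> ?g ?e2 ?e2 = 1 \<and> ?g ?e3 ?e3 = - 1 \<and> ?g ?e4 ?e4 = 1 \<and>
        ?g ?e1 ?e2 = 0 \<and> ?g ?e1 ?e3 = 0 \<and> ?g ?e1 ?e4 = 0 \<and>
        ?g ?e2 ?e3 = 0 \<and> ?g ?e2 ?e4 = 0 \<and> ?g ?e3 ?e4 = 0"
      using frame m(2) unfolding F adapted_frame_def Let_def by blast
  qed (use c I f f_nz smooth frame_smooth in auto)
qed

text \<open>Every extension of Y yields the same normal part, because the normal components depend
  only on Y by the Weingarten relation. The opposite signs of the two terms reflect that e3 is
  time-like.\<close>

lemma second_ff_eq: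
  assumes \<kappa>: "(D, \<psi>) \<in> A" "m \<in> D" and m: "m \<in> U" and Y: "Y \<in> tangent_plane A x m"
  defines "K \<equiv> \<lambda>n a. rw_metric f c (x m) Y (rw_patch.cov f c (in_chart (D, \<psi>) x) a (in_chart (D, \<psi>) n) (\<psi> m))"
  shows "second_ff f c A x m (frechet_derivative (in_chart (D, \<psi>) x) (at (\<psi> m)) a) Y =
    K e3 a *\<^sub>R e3 m - K e4 a *\<^sub>R e4 m"
proof -
  let ?X = "frechet_derivative (in_chart (D, \<psi>) x) (at (\<psi> m)) a"
  have eq: "normal_part f c A x m (rw_cov f c (x m) ?X Y (dir_deriv A x V m ?X)) = K e3 a *\<^sub>R e3 m - K e4 a *\<^sub>R e4 m"
    if W: "open W" "m \<in> W" and V: "tangent_field A x W V" "V m = Y" for W V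
  proof -
    let ?V = "in_chart (D, \<psi>) V"
    let ?\<Omega> = "\<psi> ` (D \<inter> (U \<inter> W))"
    interpret P: framed_patch f c I ?\<Omega> "in_chart (D, \<psi>) x" "in_chart (D, \<psi>) e1"
      "in_chart (D, \<psi>) e2" "in_chart (D, \<psi>) e3" "in_chart (D, \<psi>) e4" "in_chart (D, \<psi>) \<theta>"
      by (rule framed_patch_chart[OF \<kappa>(1)]) (use open_U W in auto)
    have z: "\<psi> m \<in> ?\<Omega>" using \<kappa> m W by blast
    have smV: "smooth_on ?\<Omega> ?V"
      by (rule smooth_on_subset[OF smooth_in_chart[OF \<kappa>(1), of W]]) (use V in \<open>auto simp: tangent_field_def\<close>)
    have plane: "?V z \<in> P.plane z" if "z \<in> ?\<Omega>" for z
    proof -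
      obtain q where q: "q \<in> D" "q \<in> W" "z = \<psi> q" using \<open>z \<in> ?\<Omega>\<close> by blast
      then have "V q \<in> tangent_plane A x q"
        using V(1) by (simp add: tangent_field_def)
      then show ?thesis
        using q unfolding P.plane_def
        by (simp add: in_chart_apply[OF \<kappa>(1)] tangent_plane_eq[OF \<kappa>(1)])
    qed
    note field = P.rw_field_plane[OF smV plane]
    have dd: "dir_deriv A x V m ?X = frechet_derivative ?V (at (\<psi> m)) a"
      using V W by (intro dir_deriv_eq[OF \<kappa>]) (auto simp: tangent_field_def)
    have cov: "rw_cov f c (x m) ?X Y (dir_deriv A x V m ?X) = P.cov a ?V (\<psi> m)"
      using P.rw_cov_eq_cov[OF field z, of a] unfolding dd in_chart_apply[OF \<kappa>] V(2) .
    have K: "rw_metric f c (x m) (P.cov a ?V (\<psi> m)) (e3 m) = - K e3 a"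
      "rw_metric f c (x m) (P.cov a ?V (\<psi> m)) (e4 m) = - K e4 a"
      using P.cov_normal_component[OF _ z smV plane, of "in_chart (D, \<psi>) e3" a]
        P.cov_normal_component[OF _ z smV plane, of "in_chart (D, \<psi>) e4" a]
      by (simp_all add: in_chart_apply[OF \<kappa>] V(2) K_def)
    have exp: "P.cov a ?V (\<psi> m) - (K e3 a *\<^sub>R e3 m - K e4 a *\<^sub>R e4 m) =
        rw_metric f c (x m) (P.cov a ?V (\<psi> m)) (e1 m) *\<^sub>R e1 m + rw_metric f c (x m) (P.cov a ?V (\<psi> m)) (e2 m) *\<^sub>R e2 m"
      using P.tangent_expansion[OF z P.rw_field_tangent[OF P.rw_field_cov[OF field] z], of a]
      unfolding in_chart_apply[OF \<kappa>] K by (simp add: algebra_simps)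
    show ?thesis
      unfolding cov
    proof (rule normal_part_eq)
      show "K e3 a *\<^sub>R e3 m - K e4 a *\<^sub>R e4 m \<in> normal_plane f c A x m"
        by (intro subspace_diff subspace_scale subspace_normal_plane frame_planes m)
      show "P.cov a ?V (\<psi> m) - (K e3 a *\<^sub>R e3 m - K e4 a *\<^sub>R e4 m) \<in> tangent_plane A x m"
        unfolding exp by (intro subspace_add subspace_scale subspace_tangent_plane frame_planes m)
    qed
  qed
  have "\<exists>V. tangent_field A x U V \<and> V m = Y"
  proof -
    interpret P: framed_patch f c I "\<psi> ` (D \<inter> U)" "in_chart (D, \<psi>) x" "in_chart (D, \<psi>) e1"
      "in_chart (D, \<psi>) e2" "in_chart (D, \<psi>) e3" "in_chart (D, \<psi>) e4" "in_chart (D, \<psi>) \<theta>"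
      by (rule framed_patch_chart[OF \<kappa>(1) open_U]) simp
    have z: "\<psi> m \<in> \<psi> ` (D \<inter> U)" using \<kappa> m by blast
    define y1 y2 where "y1 = rw_metric f c (x m) Y (e1 m)" and "y2 = rw_metric f c (x m) Y (e2 m)"
    \<comment> \<open>An extension exists: the frame coefficients of Y at m are kept constant on
      U.\<close>
    define V where "V q = y1 *\<^sub>R e1 q + y2 *\<^sub>R e2 q" for q
    have "Y \<in> P.plane (\<psi> m)" using Y by (simp add: P.plane_def tangent_plane_eq[OF \<kappa>])
    from P.plane_expansion[OF z this] have "V m = Y"
      by (simp add: V_def y1_def y2_def in_chart_apply[OF \<kappa>])
    moreover have "V q \<in> tangent_plane A x q" if "q \<in> U" for q
      unfolding V_def by (intro subspace_add subspace_scale subspace_tangent_plane frame_planes that)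
    moreover have "smooth_map A U V"
      unfolding smooth_map_def
    proof (clarify)
      fix D' \<psi>' assume \<kappa>': "(D', \<psi>') \<in> A"
      have "in_chart (D', \<psi>') V = (\<lambda>z. y1 *\<^sub>R in_chart (D', \<psi>') e1 z + y2 *\<^sub>R in_chart (D', \<psi>') e2 z)"
        by (auto simp: in_chart_def V_def)
      then show "smooth_on (\<psi>' ` (D' \<inter> U)) (in_chart (D', \<psi>') V)"
        using smooth_in_chart[OF \<kappa>' frame_smooth(1)] smooth_in_chart[OF \<kappa>' frame_smooth(2)]
          open_chart_image[OF \<kappa>' open_U]
        by (auto intro!: smooth_on_add smooth_on_scaleR smooth_on_const)
    qed
    ultimately show ?thesis
      by (auto simp: tangent_field_def)
  qed
  then obtain V where V: "tangent_field A x U V" "V m = Y" by blast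
  show ?thesis
    unfolding second_ff_def
  proof (rule the_equality)
    show "\<exists>W V. open W \<and> m \<in> W \<and> tangent_field A x W V \<and> V m = Y \<and>
        K e3 a *\<^sub>R e3 m - K e4 a *\<^sub>R e4 m = normal_part f c A x m (rw_cov f c (x m) ?X Y (dir_deriv A x V m ?X))"
      using open_U m V eq[OF open_U m V] by metis
  qed (use eq in metis)
qed

lemma null_iff:
  assumes \<kappa>: "(D, \<psi>) \<in> A" "m \<in> D" and m: "m \<in> U" and Y: "Y \<in> tangent_plane A x m"
  defines "K \<equiv> \<lambda>n a. rw_metric f c (x m) Y (rw_patch.cov f c (in_chart (D, \<psi>) x) a (in_chart (D, \<psi>) n) (\<psi> m))"
  shows "second_ff f c A x m (frechet_derivative (in_chart (D, \<psi>) x) (at (\<psi> m)) a) Y = 0 \<longleftrightarrow>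
    K e3 a = 0 \<and> K e4 a = 0"
proof -
  have o: "rw_metric f c (x m) (e3 m) (e3 m) = -1" "rw_metric f c (x m) (e4 m) (e4 m) = 1"
    "rw_metric f c (x m) (e3 m) (e4 m) = 0"
    using frame m unfolding adapted_frame_def Let_def by blast+
  have "k3 = 0 \<and> k4 = 0" if "k3 *\<^sub>R e3 m - k4 *\<^sub>R e4 m = 0" for k3 k4
  proof -
    have "rw_metric f c (x m) (k3 *\<^sub>R e3 m - k4 *\<^sub>R e4 m) v = 0" for v
      using that by (simp add: rw_metric_simps)
    from this[of "e3 m"] this[of "e4 m"] show ?thesis
      using o by (simp add: rw_metric_simps rw_metric_commute[of f c _ "e4 m" "e3 m"])
  qed
  then show ?thesis
    unfolding second_ff_eq[OF \<kappa> m Y] K_def by auto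
qed

text \<open>If the spanning field V of the null distribution had a nonzero e2-component at q, it
  would have one on a coordinate ball. By the pointwise result h4 then vanishes on that ball, which
  places an open part of the surface in a totally geodesic hypersurface.\<close>

lemma null_space_tangent_parallel:
  assumes curv: "\<And>t. t \<in> I \<Longrightarrow> deriv (deriv f) t / f t - ((deriv f t)\<^sup>2 + c) / (f t)\<^sup>2 \<noteq> 0"
    and not_tot_geod:
      "\<And>W S. open W \<Longrightarrow> W \<noteq> {} \<Longrightarrow> totally_geodesic_hypersurface f I c S \<Longrightarrow> \<not> x ` W \<subseteq> S"
    and line: "smooth_line_distribution A x (relative_null_space f c A x)"
    and q: "q \<in> U"
  shows "e1 q \<in> relative_null_space f c A x q"
proof -
  obtain W V where W: "open W" "q \<in> W" and V: "tangent_field A x W V"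
    and V_nz: "\<And>p. p \<in> W \<Longrightarrow> V p \<noteq> 0" and N: "\<And>p. p \<in> W \<Longrightarrow> relative_null_space f c A x p = span {V p}"
    using line unfolding smooth_line_distribution_def by metis
  obtain D \<psi> where \<kappa>: "(D, \<psi>) \<in> A" and qD: "q \<in> D" by (rule obtain_chart)
  let ?V = "in_chart (D, \<psi>) V"
  let ?\<Omega> = "\<psi> ` (D \<inter> (U \<inter> W))"
  interpret P: framed_patch f c I ?\<Omega> "in_chart (D, \<psi>) x" "in_chart (D, \<psi>) e1"
    "in_chart (D, \<psi>) e2" "in_chart (D, \<psi>) e3" "in_chart (D, \<psi>) e4" "in_chart (D, \<psi>) \<theta>"
    by (rule framed_patch_chart[OF \<kappa>]) (use open_U W in auto)
  let ?z = "\<psi> q"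
  have z: "?z \<in> ?\<Omega>" using qD q W by blast
  have smV: "smooth_on ?\<Omega> ?V"
    by (rule smooth_on_subset[OF smooth_in_chart[OF \<kappa>, of W]]) (use V in \<open>auto simp: tangent_field_def\<close>)
  have V_props: "?V z \<in> P.plane z" "?V z \<noteq> 0"
    "\<And>n a. n \<in> {in_chart (D, \<psi>) e3, in_chart (D, \<psi>) e4} \<Longrightarrow> P.K n a (?V z) z = 0"
    if z: "z \<in> ?\<Omega>" for z
  proof -
    obtain p where p: "p \<in> D" "p \<in> U" "p \<in> W" "z = \<psi> p" using z by blast
    have Vt: "V p \<in> tangent_plane A x p"
      using V p by (simp add: tangent_field_def)
    show pl: "?V z \<in> P.plane z" "?V z \<noteq> 0"
      using Vt V_nz[OF p(3)] unfolding P.plane_def p(4) in_chart_apply[OF \<kappa> p(1)] tangent_plane_eq[OF \<kappa> p(1)]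
      by auto
    fix n a assume n: "n \<in> {in_chart (D, \<psi>) e3, in_chart (D, \<psi>) e4}"
    obtain b where b: "?V z = P.d (in_chart (D, \<psi>) x) b z"
      using pl(1) unfolding P.plane_def by blast
    have t: "P.d (in_chart (D, \<psi>) x) a z \<in> tangent_plane A x p"
      unfolding tangent_plane_eq[OF \<kappa> p(1)] p(4) by blast
    have "V p \<in> relative_null_space f c A x p"
      unfolding N[OF p(3)] by (rule span_base) simp
    then have "second_ff f c A x p (V p) (P.d (in_chart (D, \<psi>) x) a z) = 0"
      using t by (simp add: relative_null_space_def)
    then have "P.K n b (P.d (in_chart (D, \<psi>) x) a z) z = 0"
      using null_iff[OF \<kappa> p(1,2) t, of b] n b unfolding p(4) in_chart_apply[OF \<kappa> p(1)] by auto
    \<comment> \<open>Nullity of V concerns the derivative of n along V; symmetry moves V into the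
      tensor slot, the form that the patch argument requires.\<close>
    then show "P.K n a (?V z) z = 0"
      unfolding b using P.K_symmetric[OF n z] by simp
  qed
  have perp: "rw_metric f c (x q) (V q) (e2 q) = 0"
  proof (rule ccontr)
    let ?h = "\<lambda>z. rw_metric f c (in_chart (D, \<psi>) x z) (?V z) (in_chart (D, \<psi>) e2 z)"
    assume "rw_metric f c (x q) (V q) (e2 q) \<noteq> 0"
    then have "?h ?z \<noteq> 0" by (simp add: in_chart_apply[OF \<kappa> qD])
    moreover have "continuous_on ?\<Omega> ?h"
      by (intro smooth_on_imp_continuous_on P.smooth_metric smV P.smooth_frame)
    then have "open {z \<in> ?\<Omega>. ?h z \<noteq> 0}"
      using continuous_open_preimage[OF _ P.\<Omega>, of ?h "-{0}"] by (simp add: vimage_def Int_def open_Compl)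
    ultimately obtain e where e: "e > 0" "ball ?z e \<subseteq> {z \<in> ?\<Omega>. ?h z \<noteq> 0}"
      using z open_contains_ball by blast
    let ?B = "ball ?z e"
    interpret B: framed_patch f c I ?B "in_chart (D, \<psi>) x" "in_chart (D, \<psi>) e1"
      "in_chart (D, \<psi>) e2" "in_chart (D, \<psi>) e3" "in_chart (D, \<psi>) e4" "in_chart (D, \<psi>) \<theta>"
      by (rule P.framed_patch_subset) (use e in auto)
    have flat: "P.K (in_chart (D, \<psi>) e4) a (P.d (in_chart (D, \<psi>) x) b z) z = 0" if z: "z \<in> ?B" for z a b
    proof (rule ccontr)
      assume nf: "P.K (in_chart (D, \<psi>) e4) a (P.d (in_chart (D, \<psi>) x) b z) z \<noteq> 0"
      have "z \<in> ?\<Omega>" "?h z \<noteq> 0" using e z by blast+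
      then show False
        using P.tangent_parallel_normal[OF smV V_props(1,2) V_props(3) curv \<open>z \<in> ?\<Omega>\<close> nf] by blast
    qed
    have "?B \<noteq> {}" using e by simp
    from B.flat_imp_totally_geodesic[OF connected_ball this flat]
    obtain S where S: "totally_geodesic_hypersurface f I c S" "in_chart (D, \<psi>) x ` ?B \<subseteq> S"
      by blast
    \<comment> \<open>The hypothesis speaks of open subsets of the surface, so the coordinate ball
      is carried back through the inverse chart.\<close>
    define W' where "W' = inv_into D \<psi> ` ?B"
    have B_sub: "?B \<subseteq> \<psi> ` D" using e by blast
    have "openin (top_of_set D) W'"
      unfolding W'_def
      by (rule homeomorphism_imp_open_map[OF homeomorphism_symD[OF chart(3)[OF \<kappa>]]])
        (use B_sub in \<open>auto intro: open_subset\<close>)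
    then have "open W'"
      using chart(1)[OF \<kappa>] openin_open_trans by blast
    moreover have "W' \<noteq> {}" using e by (auto simp: W'_def)
    moreover have "x ` W' \<subseteq> S"
      using S(2) by (auto simp: W'_def in_chart_def)
    ultimately show False
      using not_tot_geod S(1) by blast
  qed
  have "V q \<in> P.plane ?z" using V_props(1)[OF z] by (simp add: in_chart_apply[OF \<kappa> qD])
  from P.plane_expansion[OF z this] have Vq: "V q = rw_metric f c (x q) (V q) (e1 q) *\<^sub>R e1 q"
    using perp by (simp add: in_chart_apply[OF \<kappa> qD])
  define k where "k = rw_metric f c (x q) (V q) (e1 q)"
  have k: "V q = k *\<^sub>R e1 q" using Vq by (simp add: k_def)
  then have "k \<noteq> 0" using V_nz[OF W(2)] by auto
  then have "e1 q = inverse k *\<^sub>R V q" by (simp add: k)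
  then show ?thesis
    unfolding N[OF W(2)] by (metis span_base span_scale singletonI)
qed

text \<open>Linearity of h in its second argument is not visible in \<open>second_ff\<close>; it is
  borrowed from the metric expressions in \<open>null_iff\<close>.\<close>

lemma null_if_second_ff_zero:
  assumes q: "q \<in> U" and zero: "second_ff f c A x q (e1 q) (e1 q) = 0" "second_ff f c A x q (e1 q) (e2 q) = 0"
  shows "e1 q \<in> relative_null_space f c A x q"
proof -
  obtain D \<psi> where \<kappa>: "(D, \<psi>) \<in> A" "q \<in> D" by (rule obtain_chart)
  interpret P: framed_patch f c I "\<psi> ` (D \<inter> U)" "in_chart (D, \<psi>) x" "in_chart (D, \<psi>) e1"
    "in_chart (D, \<psi>) e2" "in_chart (D, \<psi>) e3" "in_chart (D, \<psi>) e4" "in_chart (D, \<psi>) \<theta>"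
    by (rule framed_patch_chart[OF \<kappa>(1) open_U]) simp
  have z: "\<psi> q \<in> \<psi> ` (D \<inter> U)" using \<kappa> q by blast
  obtain a where a: "e1 q = P.d (in_chart (D, \<psi>) x) a (\<psi> q)"
    using frame_planes(1)[OF q] unfolding tangent_plane_eq[OF \<kappa>] by blast
  have "second_ff f c A x q (e1 q) Y = 0" if Y: "Y \<in> tangent_plane A x q" for Y
  proof -
    have "Y \<in> P.plane (\<psi> q)" using Y by (simp add: P.plane_def tangent_plane_eq[OF \<kappa>])
    from P.plane_expansion[OF z this] obtain y1 y2 where "Y = y1 *\<^sub>R e1 q + y2 *\<^sub>R e2 q"
      by (simp add: in_chart_apply[OF \<kappa>])
    then show ?thesis
      using zero null_iff[OF \<kappa> q frame_planes(1)[OF q], of a] null_iff[OF \<kappa> q frame_planes(2)[OF q], of a]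
        null_iff[OF \<kappa> q Y, of a] by (simp add: a[symmetric] rw_metric_simps)
  qed
  then show ?thesis
    using frame_planes(1)[OF q] by (simp add: relative_null_space_def)
qed

text \<open>The content is smoothness. With e2 = dr a the coefficients of h(e2, e2) are derivatives
  along a, but a is merely chosen at each point; they have to be rewritten through the fixed basis
  directions.\<close>

lemma normal_field_second_ff:
  assumes zero: "\<And>q. q \<in> U \<Longrightarrow> second_ff f c A x q (e1 q) (e2 q) = 0"
  shows "normal_field f c A x U (\<lambda>q. second_ff f c A x q (e2 q) (e2 q))"
  unfolding normal_field_def
proof (intro conjI ballI)
  let ?\<xi> = "\<lambda>q. second_ff f c A x q (e2 q) (e2 q)"
  fix q assume q: "q \<in> U"
  obtain D \<psi> where \<kappa>: "(D, \<psi>) \<in> A" "q \<in> D" by (rule obtain_chart)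
  obtain a where a: "e2 q = frechet_derivative (in_chart (D, \<psi>) x) (at (\<psi> q)) a"
    using frame_planes(2)[OF q] unfolding tangent_plane_eq[OF \<kappa>] by blast
  show "?\<xi> q \<in> normal_plane f c A x q"
    using second_ff_eq[OF \<kappa> q frame_planes(2)[OF q], of a] frame_planes(3,4)[OF q] unfolding a[symmetric]
    by (simp add: subspace_diff subspace_scale subspace_normal_plane)
next
  let ?\<xi> = "\<lambda>q. second_ff f c A x q (e2 q) (e2 q)"
  show "smooth_map A U ?\<xi>"
    unfolding smooth_map_def
  proof (clarify)
    fix D \<psi> assume \<kappa>: "(D, \<psi>) \<in> A"
    let ?e1 = "in_chart (D, \<psi>) e1" and ?e2 = "in_chart (D, \<psi>) e2"
      and ?e3 = "in_chart (D, \<psi>) e3" and ?e4 = "in_chart (D, \<psi>) e4" and ?x = "in_chart (D, \<psi>) x"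
    let ?\<Omega> = "\<psi> ` (D \<inter> U)"
    interpret P: framed_patch f c I ?\<Omega> ?x ?e1 ?e2 ?e3 ?e4 "in_chart (D, \<psi>) \<theta>"
      by (rule framed_patch_chart[OF \<kappa> open_U]) simp
    \<comment> \<open>As h(e1, e2) = 0, the derivative along a basis direction k is
      \<open>w k\<close> times the wanted coefficient. Weighting by \<open>w k\<close> and summing
      gives \<open>G\<close> = \<open>M\<close> times that coefficient, with \<open>G\<close> and
      \<open>M\<close> smooth.\<close>
    define w where "w k z = rw_metric f c (?x z) (P.d ?x k z) (?e2 z)" for k z
    define M where "M z = (\<Sum>k\<in>Basis. w k z * w k z)" for z
    define G where "G n z = (\<Sum>k\<in>Basis. w k z * P.K n k (?e2 z) z)" for n z
    have main: "M z \<noteq> 0 \<and> in_chart (D, \<psi>) ?\<xi> z = (G ?e3 z / M z) *\<^sub>R ?e3 z - (G ?e4 z / M z) *\<^sub>R ?e4 z"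
      if z: "z \<in> ?\<Omega>" for z
    proof -
      obtain q where q: "q \<in> D" "q \<in> U" "z = \<psi> q" using z by blast
      note ic = in_chart_apply[OF \<kappa> q(1)]
      obtain a where a: "?e2 z = P.d ?x a z" using P.frame_tangent(2)[OF z] by blast
      obtain a1 where a1: "?e1 z = P.d ?x a1 z" using P.frame_tangent(1)[OF z] by blast
      have h12: "P.K n a1 (?e2 z) z = 0" if "n \<in> {?e3, ?e4}" for n
        using zero[OF q(2)] null_iff[OF \<kappa> q(1,2) frame_planes(2)[OF q(2)], of a1] a1 that
        unfolding q(3) ic by auto
      have h21: "P.K n a (?e1 z) z = 0" if n: "n \<in> {?e3, ?e4}" for n
        using P.K_symmetric[OF n z, of a a1] h12[OF n] a a1 by simp
      have K: "P.K n k (?e2 z) z = w k z * P.K n a (?e2 z) z" if n: "n \<in> {?e3, ?e4}" for n k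
      proof -
        have "P.K n k (?e2 z) z = P.K n a (P.d ?x k z) z"
          unfolding a by (rule P.K_symmetric[OF n z])
        also have "\<dots> = w k z * P.K n a (?e2 z) z"
          by (subst P.plane_expansion[OF z P.dr_plane[of z k]]) (simp add: rw_metric_simps h21[OF n] w_def)
        finally show ?thesis .
      qed
      have G: "G n z = M z * P.K n a (?e2 z) z" if n: "n \<in> {?e3, ?e4}" for n
        unfolding G_def M_def sum_distrib_right
        by (rule sum.cong[OF refl], subst K[OF n], rule mult.assoc[symmetric])
      \<comment> \<open>If all \<open>w k\<close> vanished on the basis, the linear map b \<mapsto>
        \<open>w b z\<close> would be zero, although it takes the value <e2, e2> = 1 at a.\<close>
      have "M z \<noteq> 0"
      proof
        assume "M z = 0"
        then have w0: "w k z = 0" if "k \<in> Basis" for k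
          using that by (simp add: M_def sum_nonneg_eq_0_iff)
        have "linear (\<lambda>b. w b z)"
          unfolding w_def by (rule linear_compose[OF P.linear_d[OF P.r z] P.linear_g, unfolded o_def])
        then have "(\<lambda>b. w b z) = (\<lambda>_. 0)"
          by (rule linear_eq_stdbasis) (auto simp: w0 linear_zero)
        then have "w a z = 0" by (rule fun_cong)
        then show False
          using P.orthonormal'(2)[OF z] by (simp add: w_def flip: a)
      qed
      moreover have "in_chart (D, \<psi>) ?\<xi> z = P.K ?e3 a (?e2 z) z *\<^sub>R ?e3 z - P.K ?e4 a (?e2 z) z *\<^sub>R ?e4 z"
        using second_ff_eq[OF \<kappa> q(1,2) frame_planes(2)[OF q(2)], of a] a unfolding q(3) ic by simp
      ultimately show ?thesis
        using G by simp
    qed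
    have "smooth_on ?\<Omega> (w k)" for k
      unfolding w_def
      by (intro P.smooth_metric smooth_on_frechet_derivative P.r P.smooth_frame)
    then have "smooth_on ?\<Omega> M" "smooth_on ?\<Omega> (G ?e3)" "smooth_on ?\<Omega> (G ?e4)"
      unfolding M_def G_def
      by (auto intro!: smooth_on_sum smooth_on_mult P.smooth_K P.smooth_frame P.\<Omega>)
    then have "smooth_on ?\<Omega> (\<lambda>z. (G ?e3 z / M z) *\<^sub>R ?e3 z - (G ?e4 z / M z) *\<^sub>R ?e4 z)"
      using main by (intro smooth_on_diff smooth_on_scaleR smooth_on_divide P.\<Omega> P.smooth_frame) auto
    then show "smooth_on ?\<Omega> (in_chart (D, \<psi>) ?\<xi>)"
      by (rule smooth_on_cong[OF P.\<Omega>, rotated]) (use main in auto)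
  qed
qed

end

text \<open>Frames are local, so a family of them with domains covering the surface is given. The
  forward direction holds on each domain separately; the converse uses the covering to find a frame
  at every point.\<close>

theorem proposition3p1:
  fixes c :: real and I :: "real set" and f :: "real \<Rightarrow> real"
    and A :: "'m::{t2_space, second_countable_topology} chart set"
    and x :: "'m \<Rightarrow> amb"
    and U :: "'i \<Rightarrow> 'm set"
    and e1 e2 e3 e4 :: "'i \<Rightarrow> 'm \<Rightarrow> amb"
    and \<theta> :: "'i \<Rightarrow> 'm \<Rightarrow> real"
  assumes c: "c \<in> {-1, 0, 1}"
    and I: "open I" "is_interval I"
    and f: "smooth_on I f" "\<forall>t\<in>I. f t \<noteq> 0"
    and not_const_curv:
      "\<forall>t\<in>I. deriv (deriv f) t / f t - ((deriv f t)\<^sup>2 + c) / (f t)\<^sup>2 \<noteq> 0"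
    and surface: "immersed_surface I c A x" "spacelike f c A x"
    and T_nonzero: "\<forall>m. tangential_part f c A x m partial_t \<noteq> 0"
    and distribution:
      "positive_relative_nullity f c A x \<longrightarrow>
         smooth_line_distribution A x (relative_null_space f c A x)"
    and conn: "connected (UNIV :: 'm set)"
    and not_tot_geod:
      "\<forall>W S. open W \<and> W \<noteq> {} \<and> totally_geodesic_hypersurface f I c S \<longrightarrow> \<not> x ` W \<subseteq> S"
    and frames: "\<forall>i. adapted_frame f c A x (U i) (e1 i) (e2 i) (e3 i) (e4 i) (\<theta> i)"
    and cover: "(\<Union>i. U i) = UNIV"
  shows "positive_relative_nullity f c A x \<longleftrightarrow>
    (\<forall>i. \<exists>\<xi>. normal_field f c A x (U i) \<xi> \<and>
       (\<forall>q\<in>U i. second_ff f c A x q (e1 i q) (e1 i q) = 0 \<and>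
                 second_ff f c A x q (e1 i q) (e2 i q) = 0 \<and>
                 second_ff f c A x q (e2 i q) (e2 i q) = \<xi> q))"
proof -
  have loc: "framed_surface c I f A x (U i) (e1 i) (e2 i) (e3 i) (e4 i) (\<theta> i)" for i
    using c I f surface T_nonzero frames by unfold_locales auto
  show ?thesis
  proof (intro iffI allI)
    fix i
    assume pos: "positive_relative_nullity f c A x"
    interpret framed_surface c I f A x "U i" "e1 i" "e2 i" "e3 i" "e4 i" "\<theta> i" by (rule loc)
    have null: "e1 i q \<in> relative_null_space f c A x q" if "q \<in> U i" for q
      using not_const_curv not_tot_geod distribution pos that by (intro null_space_tangent_parallel) auto
    have h: "second_ff f c A x q (e1 i q) (e1 i q) = 0" "second_ff f c A x q (e1 i q) (e2 i q) = 0"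
      if "q \<in> U i" for q
      using null[OF that] frame_planes(1,2)[OF that] by (auto simp: relative_null_space_def)
    show "\<exists>\<xi>. normal_field f c A x (U i) \<xi> \<and>
       (\<forall>q\<in>U i. second_ff f c A x q (e1 i q) (e1 i q) = 0 \<and>
                 second_ff f c A x q (e1 i q) (e2 i q) = 0 \<and>
                 second_ff f c A x q (e2 i q) (e2 i q) = \<xi> q)"
      using normal_field_second_ff h by blast
  next
    assume h: "\<forall>i. \<exists>\<xi>. normal_field f c A x (U i) \<xi> \<and>
       (\<forall>q\<in>U i. second_ff f c A x q (e1 i q) (e1 i q) = 0 \<and>
                 second_ff f c A x q (e1 i q) (e2 i q) = 0 \<and>
                 second_ff f c A x q (e2 i q) (e2 i q) = \<xi> q)"
    show "positive_relative_nullity f c A x"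
      unfolding positive_relative_nullity_def
    proof
      fix m
      obtain i where i: "m \<in> U i" using cover by blast
      interpret framed_surface c I f A x "U i" "e1 i" "e2 i" "e3 i" "e4 i" "\<theta> i" by (rule loc)
      have "e1 i m \<in> relative_null_space f c A x m"
        using h i by (intro null_if_second_ff_zero) blast+
      \<comment> \<open>The null space contains e1, which has unit length and is therefore nonzero,
        so the dimension is at least 1.\<close>
      then have "dim {e1 i m} \<le> dim (relative_null_space f c A x m)"
        by (intro dim_subset) simp
      moreover have "rw_metric f c (x m) (e1 i m) (e1 i m) = 1"
        using frame i unfolding adapted_frame_def Let_def by blast
      then have "e1 i m \<noteq> 0" by (auto simp: rw_metric_simps)
      ultimately show "dim (relative_null_space f c A x m) > 0"
        by (simp add: dim_singleton)
    qed
  qed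
qed

end
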